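(* Let $n\ge3$. For every bilinear biform $g\in\mathbb R[x,y]_{1,1}/I_{1,1}$, $$\left(\int_Tg^4\,d\sigma\right)^{1/4}=\|g\|_4\le\sqrt6\,\|g\|_2=\sqrt6\left(\int_Tg^2\,d\sigma\right)^{1/2}.$$ If $g$ is symmetric, then $\sqrt6$ can be replaced by $\sqrt3$, while if $g$ is skew-symmetric, $\sqrt6$ can be replaced by $\sqrt[4]{6}$. Moreover, the constants $\sqrt3$ (for symmetric $g$) and $\sqrt[4]{6}$ (for skew-symmetric $g$) are asymptotically sharp as $n\to\infty$.
   Context: $x=(x_1,\dots,x_n)$, $y=(y_1,\dots,y_n)$ are tuples of commuting variables; $\mathbb R[x,y]_{1,1}$ is the space of polynomials homogeneous of degree $1$ in $x$ and of degree $1$ in $y$ (bilinear forms); $I\subseteq\mathbb R[x,y]$ is the ideal generated by $\sum_{i=1}^nx_iy_i$ and $I_{1,1}=I\cap\mathbb R[x,y]_{1,1}$. Let $T=\{(x,y)\in\mathbb R^n\times\mathbb R^n:\|x\|=\|y\|=1,\ y^Tx=0\}$ and let $\sigma$ be the unique normalized (total mass $1$) Borel measure on $T$ invariant under the action $g(x,y)=(gx,gy)$ of $SO(n)$. Elements of $\mathbb R[x,y]_{1,1}/I_{1,1}$ are functions on $T$. Such an element is symmetric (resp. skew-symmetric) if it is of the form $x^TAy+I_{1,1}$ for some symmetric (resp. skew-symmetric) matrix $A\in\mathbb R^{n\times n}$. Asymptotic sharpness of a constant $C$ means that the supremum of $\|g\|_4/\|g\|_2$ over nonzero $g$ in the given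 class (for dimension $n$) tends to $C$ as $n\to\infty$. *)

theory Defs
  imports
    "HOL-Probability.Probability"
    "HOL-Library.Poly_Mapping"
    "Jordan_Normal_Form.Determinant"
begin

unbundle no inner_syntax and no vec_syntax

text \<open>
  The dimension \<open>n\<close> tends to infinity in the result, so \<open>\<real>\<^sup>n\<close> is \<^term>\<open>carrier_vec n\<close> and the
  \<open>n \<times> n\<close> matrices are \<^term>\<open>carrier_mat n n\<close>. A polynomial maps each monomial to its
  coefficient and a monomial maps each variable to its exponent; with indices starting at 0,
  \<open>Inl i\<close> is the variable \<open>x\<^sub>i\<close> and \<open>Inr i\<close> is the variable \<open>y\<^sub>i\<close>.
\<close>

type_synonym xy_monom = "(nat + nat) \<Rightarrow>\<^sub>0 nat"
type_synonym xy_poly = "xy_monom \<Rightarrow>\<^sub>0 real"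

definition xy_polys :: "nat \<Rightarrow> xy_poly set" where
  "xy_polys n = {p. \<forall>m \<in> Poly_Mapping.keys p. Poly_Mapping.keys m \<subseteq> Inl ` {..<n} \<union> Inr ` {..<n}}"

definition x_degree :: "nat \<Rightarrow> xy_monom \<Rightarrow> nat" where
  "x_degree n m = (\<Sum>i<n. Poly_Mapping.lookup m (Inl i))"

definition y_degree :: "nat \<Rightarrow> xy_monom \<Rightarrow> nat" where
  "y_degree n m = (\<Sum>i<n. Poly_Mapping.lookup m (Inr i))"

definition biforms :: "nat \<Rightarrow> xy_poly set" where
  "biforms n = {p \<in> xy_polys n. \<forall>m \<in> Poly_Mapping.keys p. x_degree n m = 1 \<and> y_degree n m = 1}"

definition monom_xy :: "nat \<Rightarrow> nat \<Rightarrow> xy_monom" where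
  "monom_xy i j = Poly_Mapping.single (Inl i) 1 + Poly_Mapping.single (Inr j) 1"

text \<open>The polynomial \<open>x\<^sup>T A y\<close>.\<close>

definition matrix_biform :: "nat \<Rightarrow> real mat \<Rightarrow> xy_poly" where
  "matrix_biform n A = (\<Sum>i<n. \<Sum>j<n. Poly_Mapping.single (monom_xy i j) (A $$ (i, j)))"

definition incidence_poly :: "nat \<Rightarrow> xy_poly" where
  "incidence_poly n = (\<Sum>i<n. Poly_Mapping.single (monom_xy i i) 1)"

definition incidence_ideal :: "nat \<Rightarrow> xy_poly set" where
  "incidence_ideal n = (\<lambda>q. q * incidence_poly n) ` xy_polys n"

definition incidence_biforms :: "nat \<Rightarrow> xy_poly set" where
  "incidence_biforms n = incidence_ideal n \<inter> biforms n"

definition biform_class :: "nat \<Rightarrow> xy_poly \<Rightarrow> xy_poly set" where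
  "biform_class n p = (+) p ` incidence_biforms n"

text \<open>The quotient space \<open>\<real>[x,y]\<^sub>1\<^sub>,\<^sub>1 / I\<^sub>1\<^sub>,\<^sub>1\<close> and its (skew-)symmetric elements.\<close>

definition biform_classes :: "nat \<Rightarrow> xy_poly set set" where
  "biform_classes n = biform_class n ` biforms n"

definition symmetric_classes :: "nat \<Rightarrow> xy_poly set set" where
  "symmetric_classes n =
    {biform_class n (matrix_biform n A) |A. A \<in> carrier_mat n n \<and> transpose_mat A = A}"

definition skew_symmetric_classes :: "nat \<Rightarrow> xy_poly set set" where
  "skew_symmetric_classes n =
    {biform_class n (matrix_biform n A) |A. A \<in> carrier_mat n n \<and> transpose_mat A = - A}"

definition eval_xy :: "xy_poly \<Rightarrow> real vec \<times> real vec \<Rightarrow> real" where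
  "eval_xy p = (\<lambda>(x, y). \<Sum>m \<in> Poly_Mapping.keys p. Poly_Mapping.lookup p m *
     (\<Prod>v \<in> Poly_Mapping.keys m. (case v of Inl i \<Rightarrow> x $ i | Inr i \<Rightarrow> y $ i) ^ Poly_Mapping.lookup m v))"

text \<open>
  The function on \<open>T\<close> given by a class: the common value of all its representatives, which is
  well defined because \<^const>\<open>incidence_poly\<close> vanishes on \<open>T\<close>.
\<close>

definition class_fun :: "xy_poly set \<Rightarrow> real vec \<times> real vec \<Rightarrow> real" where
  "class_fun g z = the_elem ((\<lambda>p. eval_xy p z) ` g)"

definition T_space :: "nat \<Rightarrow> (real vec \<times> real vec) set" where
  "T_space n = {(x, y). x \<in> carrier_vec n \<and> y \<in> carrier_vec n \<and>
     sqrt (x \<bullet> x) = 1 \<and> sqrt (y \<bullet> y) = 1 \<and> y \<bullet> x = 0}"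

text \<open>
  \<^typ>\<open>real vec\<close> carries no topology; the Borel sets of \<open>T\<close> are the traces of the Borel sets of
  \<open>\<real>\<^sup>n \<times> \<real>\<^sup>n\<close>, the latter being the products of \<open>n\<close> copies of \<^term>\<open>borel :: real measure\<close>.
\<close>

definition vec_coords :: "nat \<Rightarrow> real vec \<Rightarrow> nat \<Rightarrow> real" where
  "vec_coords n x = (\<lambda>i \<in> {..<n}. x $ i)"

definition T_borel :: "nat \<Rightarrow> (real vec \<times> real vec) measure" where
  "T_borel n = vimage_algebra (T_space n) (map_prod (vec_coords n) (vec_coords n))
     ((\<Pi>\<^sub>M i \<in> {..<n}. borel) \<Otimes>\<^sub>M (\<Pi>\<^sub>M i \<in> {..<n}. borel))"

definition special_orthogonal :: "nat \<Rightarrow> real mat set" where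
  "special_orthogonal n = {Q \<in> carrier_mat n n. transpose_mat Q * Q = 1\<^sub>m n \<and> det Q = 1}"

text \<open>
  The normalized \<open>SO(n)\<close>-invariant Borel measures on \<open>T\<close>; for \<open>n \<ge> 3\<close> the action is transitive
  and there is exactly one.
\<close>

definition invariant_prob_T :: "nat \<Rightarrow> (real vec \<times> real vec) measure \<Rightarrow> bool" where
  "invariant_prob_T n M \<longleftrightarrow> prob_space M \<and> space M = T_space n \<and> sets M = sets (T_borel n) \<and>
     (\<forall>Q \<in> special_orthogonal n. distr M M (map_prod ((*\<^sub>v) Q) ((*\<^sub>v) Q)) = M)"

definition class_norm :: "(real vec \<times> real vec) measure \<Rightarrow> nat \<Rightarrow> xy_poly set \<Rightarrow> real" where
  "class_norm M p g = root p (\<integral>z. \<bar>class_fun g z\<bar> ^ p \<partial>M)"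

text \<open>
  \<^term>\<open>biform_class n 0\<close> is the zero element of the quotient.
\<close>

definition sharp_ratio ::
    "(real vec \<times> real vec) measure \<Rightarrow> nat \<Rightarrow> xy_poly set set \<Rightarrow> real" where
  "sharp_ratio M n G = (SUP g \<in> G - {biform_class n 0}. class_norm M 4 g / class_norm M 2 g)"

end

theory Submission
  imports Defs "HOL-Real_Asymp.Real_Asymp"
begin

text \<open>
  Invariance under rotations makes \<open>\<integral> L\<^sub>i\<^sub>j f d\<sigma>\<close> vanish for every polynomial \<open>f\<close>, where \<open>L\<^sub>i\<^sub>j\<close>
  is the derivative along the rotation of the coordinate plane \<open>(i, j)\<close>, acting on \<open>x\<close> and \<open>y\<close>
  simultaneously. Taking \<open>f = u\<^sub>i F\<^sub>j\<close> with \<open>u = x\<close> or \<open>u = y\<close> and summing over \<open>i, j\<close> turns this into a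
  divergence theorem, \<open>divergence_identity\<close>. For \<open>u = x\<close> and a vector field \<open>F(x)\<close> it is integration by
  parts on the unit sphere of \<open>\<real>\<^sup>n\<close> (\<open>integral_quad_mult\<close>); for \<open>u = y\<close> and \<open>F = f a\<close> with \<open>a(x)\<close>
  orthogonal to \<open>x\<close> it is integration by parts over \<open>y\<close> in the unit sphere of the hyperplane orthogonal
  to \<open>x\<close> (\<open>integral_tangent_mult\<close>). Each application lowers the degree of the integrand, and the
  integrals below reduce to traces. In this way invariance and total
  mass 1 determine every integral that occurs.

  On \<open>T\<close> the form \<open>x\<^sup>T A y\<close> depends on \<open>A\<close> modulo the identity, so \<open>A = S + K\<close> with \<open>S\<close> symmetric of
  trace 0 and \<open>K\<close> skew-symmetric. Write \<open>s\<close> and \<open>k\<close> for the two forms, \<open>\<parallel>\<cdot>\<parallel>\<close> for the Frobenius norm.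
  Integrating over \<open>y\<close> first gives \<open>3 |a(x)|\<^sup>4 / (n\<^sup>2 - 1)\<close> for the fourth power, where \<open>a(x)\<close> is the
  component of \<open>S x\<close> or \<open>K\<^sup>T x\<close> orthogonal to \<open>x\<close>, and then
    \<open>\<integral> s\<^sup>2 = \<parallel>S\<parallel>\<^sup>2 / ((n-1)(n+2))\<close>,
    \<open>\<integral> s\<^sup>4 = 3 ((n\<^sup>2+6n+12) \<parallel>S\<parallel>\<^sup>4 + 2n(n+2) \<parallel>S\<^sup>2\<parallel>\<^sup>2) / ((n\<^sup>2-1)n(n+2)(n+4)(n+6))\<close>,
    \<open>\<integral> k\<^sup>2 = \<parallel>K\<parallel>\<^sup>2 / (n(n-1))\<close>,
    \<open>\<integral> k\<^sup>4 = 3 (\<parallel>K\<parallel>\<^sup>4 + 2 \<parallel>K K\<^sup>T\<parallel>\<^sup>2) / ((n\<^sup>2-1)n(n+2))\<close>.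
  Submultiplicativity \<open>\<parallel>S\<^sup>2\<parallel> \<le> \<parallel>S\<parallel>\<^sup>2\<close> yields \<open>\<integral> s\<^sup>4 \<le> 9 (\<integral> s\<^sup>2)\<^sup>2\<close>. The nonzero singular values of \<open>K\<close>
  come in equal pairs, whence \<open>2 \<parallel>K K\<^sup>T\<parallel>\<^sup>2 \<le> \<parallel>K\<parallel>\<^sup>4\<close> and \<open>\<integral> k\<^sup>4 \<le> 6 (\<integral> k\<^sup>2)\<^sup>2\<close>. For general \<open>A\<close> the forms
  \<open>s\<close> and \<open>k\<close> are orthogonal in \<open>L\<^sup>2\<close>, and \<open>(s + k)\<^sup>2 \<le> 2 s\<^sup>2 + 2 k\<^sup>2\<close> together with the Cauchy-Schwarz
  inequality gives the factor 36, that is \<open>\<surd>6\<close> to the fourth power.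

  For sharpness, \<open>\<parallel>S\<^sup>2\<parallel> / \<parallel>S\<parallel>\<^sup>2\<close> tends to 1 for the traceless part of a matrix with one nonzero entry on the
  diagonal (the form \<open>x\<^sub>0 y\<^sub>0\<close>), and \<open>2 \<parallel>K K\<^sup>T\<parallel>\<^sup>2 = \<parallel>K\<parallel>\<^sup>4\<close> for skew-symmetric matrices of rank 2 (the form
  \<open>x\<^sub>0 y\<^sub>1 - x\<^sub>1 y\<^sub>0\<close>). The quotients of the fourth moment by the squared second moment are then bounded
  below by rational functions of \<open>n\<close> with limits 9 and 6.
\<close>

section \<open>Classes of biforms as functions on \<open>T\<close>\<close>

definition xc :: "nat \<Rightarrow> real vec \<times> real vec \<Rightarrow> real" where
  "xc i z = fst z $ i"

definition yc :: "nat \<Rightarrow> real vec \<times> real vec \<Rightarrow> real" where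
  "yc i z = snd z $ i"

definition bilin :: "nat \<Rightarrow> (nat \<Rightarrow> nat \<Rightarrow> real) \<Rightarrow> real vec \<times> real vec \<Rightarrow> real" where
  "bilin n A z = (\<Sum>i<n. \<Sum>j<n. A i j * xc i z * yc j z)"

lemma T_space_coords:
  "z \<in> T_space n \<longleftrightarrow> fst z \<in> carrier_vec n \<and> snd z \<in> carrier_vec n \<and>
     (\<Sum>i<n. xc i z * xc i z) = 1 \<and> (\<Sum>i<n. yc i z * yc i z) = 1 \<and> (\<Sum>i<n. xc i z * yc i z) = 0"
  by (auto simp: T_space_def scalar_prod_def xc_def yc_def atLeast0LessThan mult.commute split: prod.splits)

definition eval_monom :: "real vec \<times> real vec \<Rightarrow> xy_monom \<Rightarrow> real" where
  "eval_monom z m = (\<Prod>v \<in> Poly_Mapping.keys m.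
     (case v of Inl i \<Rightarrow> xc i z | Inr i \<Rightarrow> yc i z) ^ Poly_Mapping.lookup m v)"

lemma eval_monom_superset:
  assumes "finite V" "Poly_Mapping.keys m \<subseteq> V"
  shows "eval_monom z m = (\<Prod>v \<in> V. (case v of Inl i \<Rightarrow> xc i z | Inr i \<Rightarrow> yc i z) ^ Poly_Mapping.lookup m v)"
  unfolding eval_monom_def
  by (rule prod.mono_neutral_left) (use assms in \<open>auto simp: in_keys_iff\<close>)

lemma eval_monom_add: "eval_monom z (m + m') = eval_monom z m * eval_monom z m'"
proof -
  let ?V = "Poly_Mapping.keys m \<union> Poly_Mapping.keys m'"
  have "Poly_Mapping.keys (m + m') \<subseteq> ?V" by (rule keys_add)
  then show ?thesis
    by (simp add: eval_monom_superset[of ?V] lookup_add power_add prod.distrib)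
qed

lemma eval_monom_xy: "eval_monom z (monom_xy i j) = xc i z * yc j z"
  unfolding monom_xy_def eval_monom_add by (simp add: eval_monom_def)

lemma eval_xy_superset:
  assumes "finite S" "Poly_Mapping.keys p \<subseteq> S"
  shows "eval_xy p z = (\<Sum>m \<in> S. Poly_Mapping.lookup p m * eval_monom z m)"
proof -
  have "eval_xy p z = (\<Sum>m \<in> Poly_Mapping.keys p. Poly_Mapping.lookup p m * eval_monom z m)"
    unfolding eval_xy_def eval_monom_def xc_def yc_def by (simp add: case_prod_unfold)
  also have "\<dots> = (\<Sum>m \<in> S. Poly_Mapping.lookup p m * eval_monom z m)"
    by (rule sum.mono_neutral_left) (use assms in \<open>auto simp: in_keys_iff\<close>)
  finally show ?thesis .
qed

lemma eval_xy_zero: "eval_xy 0 z = 0"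
  by (simp add: eval_xy_superset[of "{}"])

lemma eval_xy_add: "eval_xy (p + q) z = eval_xy p z + eval_xy q z"
proof -
  let ?S = "Poly_Mapping.keys p \<union> Poly_Mapping.keys q"
  have "Poly_Mapping.keys (p + q) \<subseteq> ?S" by (rule keys_add)
  then show ?thesis
    by (simp add: eval_xy_superset[of ?S] lookup_add distrib_right sum.distrib)
qed

lemma eval_xy_sum: "eval_xy (\<Sum>a \<in> S. f a) z = (\<Sum>a \<in> S. eval_xy (f a) z)"
  by (induction S rule: infinite_finite_induct) (simp_all add: eval_xy_zero eval_xy_add)

lemma eval_xy_single: "eval_xy (Poly_Mapping.single m c) z = c * eval_monom z m"
  by (simp add: eval_xy_superset[of "{m}"])

lemma sum_singles: "p = (\<Sum>m \<in> Poly_Mapping.keys p. Poly_Mapping.single m (Poly_Mapping.lookup p m))"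
  by (rule poly_mapping_eqI) (simp add: lookup_sum lookup_single when_def in_keys_iff)

text \<open>
  Evaluation is multiplicative on monomials because exponents add; writing both factors as finite sums
  of single terms extends this to all polynomials.
\<close>

lemma eval_xy_mult: "eval_xy (p * q) z = eval_xy p z * eval_xy q z"
proof -
  let ?s = "\<lambda>p m. Poly_Mapping.single m (Poly_Mapping.lookup p m)"
  have "p * q = (\<Sum>m \<in> Poly_Mapping.keys p. ?s p m) * (\<Sum>m \<in> Poly_Mapping.keys q. ?s q m)"
    using sum_singles[of p] sum_singles[of q] by simp
  also have "\<dots> = (\<Sum>m \<in> Poly_Mapping.keys p. \<Sum>m' \<in> Poly_Mapping.keys q. ?s p m * ?s q m')"
    by (simp add: sum_product)
  finally have "eval_xy (p * q) z = (\<Sum>m \<in> Poly_Mapping.keys p. \<Sum>m' \<in> Poly_Mapping.keys q.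
      (Poly_Mapping.lookup p m * eval_monom z m) * (Poly_Mapping.lookup q m' * eval_monom z m'))"
    by (simp add: eval_xy_sum mult_single eval_xy_single eval_monom_add mult_ac)
  also have "\<dots> = eval_xy p z * eval_xy q z"
    by (simp add: eval_xy_superset[OF finite_keys subset_refl] sum_product)
  finally show ?thesis .
qed

lemma incidence_poly_vanishes: "z \<in> T_space n \<Longrightarrow> eval_xy (incidence_poly n) z = 0"
  by (simp add: incidence_poly_def eval_xy_sum eval_xy_single eval_monom_xy T_space_coords)

lemma zero_in_incidence_biforms: "0 \<in> incidence_biforms n"
  by (auto simp: incidence_biforms_def incidence_ideal_def biforms_def xy_polys_def
      intro!: image_eqI[of _ _ 0])

text \<open>
  Two representatives differ by a multiple of \<open>incidence_poly\<close>, whose value at \<open>(x, y)\<close> is the inner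
  product of \<open>x\<close> and \<open>y\<close>. As 0 is one of these multiples, the set of values is a singleton.
\<close>

lemma class_fun_eq_eval:
  assumes "z \<in> T_space n"
  shows "class_fun (biform_class n p) z = eval_xy p z"
proof -
  have "eval_xy (p + r) z = eval_xy p z" if "r \<in> incidence_biforms n" for r
    using that assms by (auto simp: incidence_biforms_def incidence_ideal_def eval_xy_add eval_xy_mult
        incidence_poly_vanishes)
  then have "(\<lambda>p. eval_xy p z) ` biform_class n p = {eval_xy p z}"
    using zero_in_incidence_biforms[of n] by (force simp: biform_class_def image_image)
  then show ?thesis by (simp add: class_fun_def)
qed

lemma eval_matrix_biform:
  "eval_xy (matrix_biform n A) z = bilin n (\<lambda>i j. A $$ (i, j)) z"
  by (simp add: matrix_biform_def eval_xy_sum eval_xy_single eval_monom_xy bilin_def mult.assoc)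

text \<open>
  A sum of natural numbers that equals 1 has one summand 1 and all others 0, which picks out one
  variable \<open>x\<^sub>i\<close> and one variable \<open>y\<^sub>j\<close>.
\<close>

lemma biform_monomials:
  assumes "p \<in> biforms n" "m \<in> Poly_Mapping.keys p"
  shows "\<exists>i<n. \<exists>j<n. m = monom_xy i j"
proof -
  have k: "Poly_Mapping.keys m \<subseteq> Inl ` {..<n} \<union> Inr ` {..<n}"
    and x: "(\<Sum>i<n. Poly_Mapping.lookup m (Inl i)) = 1" and y: "(\<Sum>i<n. Poly_Mapping.lookup m (Inr i)) = 1"
    using assms by (auto simp: biforms_def xy_polys_def x_degree_def y_degree_def)
  have fin: "finite {..<n}" by simp
  from x obtain i where i: "i < n" "Poly_Mapping.lookup m (Inl i) = 1"
    "\<And>i'. i' < n \<Longrightarrow> i' \<noteq> i \<Longrightarrow> Poly_Mapping.lookup m (Inl i') = 0"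
    unfolding sum_eq_1_iff[OF fin] by auto
  from y obtain j where j: "j < n" "Poly_Mapping.lookup m (Inr j) = 1"
    "\<And>j'. j' < n \<Longrightarrow> j' \<noteq> j \<Longrightarrow> Poly_Mapping.lookup m (Inr j') = 0"
    unfolding sum_eq_1_iff[OF fin] by auto
  have "Poly_Mapping.lookup m v = Poly_Mapping.lookup (monom_xy i j) v" for v
  proof (cases v)
    case (Inl a)
    then show ?thesis using i k by (cases "a < n"; cases "a = i")
        (auto simp: monom_xy_def lookup_add lookup_single in_keys_iff)
  next
    case (Inr a)
    then show ?thesis using j k by (cases "a < n"; cases "a = j")
        (auto simp: monom_xy_def lookup_add lookup_single in_keys_iff)
  qed
  then have "m = monom_xy i j" by (rule poly_mapping_eqI)
  with i j show ?thesis by auto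
qed

lemma monom_xy_inject: "monom_xy i j = monom_xy i' j' \<longleftrightarrow> i = i' \<and> j = j'"
proof
  assume eq: "monom_xy i j = monom_xy i' j'"
  have "Poly_Mapping.lookup (monom_xy i j) (Inl i) = 1" "Poly_Mapping.lookup (monom_xy i j) (Inr j) = 1"
    by (simp_all add: monom_xy_def lookup_add lookup_single)
  then have "Poly_Mapping.lookup (monom_xy i' j') (Inl i) = 1" "Poly_Mapping.lookup (monom_xy i' j') (Inr j) = 1"
    by (simp_all add: eq)
  then show "i = i' \<and> j = j'"
    by (auto simp: monom_xy_def lookup_add lookup_single when_def split: if_splits)
qed simp

lemma eval_biform:
  assumes "p \<in> biforms n"
  shows "eval_xy p z = bilin n (\<lambda>i j. Poly_Mapping.lookup p (monom_xy i j)) z"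
proof -
  let ?S = "(\<lambda>(i, j). monom_xy i j) ` ({..<n} \<times> {..<n})"
  have inj: "inj_on (\<lambda>(i, j). monom_xy i j) ({..<n} \<times> {..<n})"
    by (auto simp: inj_on_def monom_xy_inject)
  have "Poly_Mapping.keys p \<subseteq> ?S"
    using biform_monomials[OF assms] by fastforce
  then have "eval_xy p z = (\<Sum>m \<in> ?S. Poly_Mapping.lookup p m * eval_monom z m)"
    by (intro eval_xy_superset) auto
  also have "\<dots> = bilin n (\<lambda>i j. Poly_Mapping.lookup p (monom_xy i j)) z"
    unfolding sum.reindex[OF inj]
    by (simp add: bilin_def sum.cartesian_product eval_monom_xy case_prod_unfold mult.assoc)
  finally show ?thesis .
qed

section \<open>Rotations of coordinate planes\<close>

definition givens :: "nat \<Rightarrow> nat \<Rightarrow> nat \<Rightarrow> real \<Rightarrow> real mat" where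
  "givens n i j t = mat n n (\<lambda>(a, b).
     if a = i then (if b = i then cos t else if b = j then - sin t else 0)
     else if a = j then (if b = i then sin t else if b = j then cos t else 0)
     else if a = b then 1 else 0)"

lemma givens_carrier: "givens n i j t \<in> carrier_mat n n"
  by (simp add: givens_def)

lemma givens_mult_vec:
  assumes "i < n" "j < n" "i \<noteq> j" "v \<in> carrier_vec n"
  shows "givens n i j t *\<^sub>v v = vec n (\<lambda>a. if a = i then cos t * v $ i - sin t * v $ j
      else if a = j then sin t * v $ i + cos t * v $ j else v $ a)"
proof (rule eq_vecI)
  fix a assume "a < dim_vec (vec n (\<lambda>a. if a = i then cos t * v $ i - sin t * v $ j
      else if a = j then sin t * v $ i + cos t * v $ j else v $ a))"
  then have a: "a < n" by simp
  let ?r = "\<lambda>b. if a = i then (if b = i then cos t else if b = j then - sin t else 0)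
     else if a = j then (if b = i then sin t else if b = j then cos t else 0)
     else if a = b then 1 else 0"
  have "(givens n i j t *\<^sub>v v) $ a = (\<Sum>b<n. ?r b * v $ b)"
    using a assms by (auto simp: givens_def scalar_prod_def atLeast0LessThan intro!: sum.cong)
  also have "\<dots> = (\<Sum>b<n. (if b = i then ?r i * v $ i else 0) + (if b = j then ?r j * v $ j else 0)
      + (if b = a then (if a = i \<or> a = j then 0 else v $ a) else 0))"
    using assms by (intro sum.cong) auto
  also have "\<dots> = ?r i * v $ i + ?r j * v $ j + (if a = i \<or> a = j then 0 else v $ a)"
    using assms a by (simp add: sum.distrib)
  finally show "(givens n i j t *\<^sub>v v) $ a = vec n (\<lambda>a. if a = i then cos t * v $ i - sin t * v $ j
      else if a = j then sin t * v $ i + cos t * v $ j else v $ a) $ a"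
    using a assms by auto
qed (simp add: givens_def)

lemma givens_add:
  assumes "i < n" "j < n" "i \<noteq> j"
  shows "givens n i j s * givens n i j t = givens n i j (s + t)"
proof (rule eq_matI)
  fix a b assume "a < dim_row (givens n i j (s + t))" "b < dim_col (givens n i j (s + t))"
  then have ab: "a < n" "b < n" by (auto simp: givens_def)
  have "(givens n i j s * givens n i j t) $$ (a, b) = (givens n i j s *\<^sub>v col (givens n i j t) b) $ a"
    using ab by (simp add: givens_def)
  also have "\<dots> = givens n i j (s + t) $$ (a, b)"
    using ab assms
    by (subst givens_mult_vec[OF assms]) (auto simp: givens_def cos_add sin_add)
  finally show "(givens n i j s * givens n i j t) $$ (a, b) = givens n i j (s + t) $$ (a, b)" .
qed (auto simp: givens_def)

lemma givens_zero: "i \<noteq> j \<Longrightarrow> givens n i j 0 = 1\<^sub>m n"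
  by (auto simp: givens_def intro!: eq_matI)

lemma givens_transpose: "i \<noteq> j \<Longrightarrow> transpose_mat (givens n i j t) = givens n i j (- t)"
  by (auto simp: givens_def intro!: eq_matI)

text \<open>A rotation is the square of the rotation by half the angle, so its determinant is not \<open>-1\<close>.\<close>

lemma givens_special_orthogonal:
  assumes "i < n" "j < n" "i \<noteq> j"
  shows "givens n i j t \<in> special_orthogonal n"
proof -
  have orth: "transpose_mat (givens n i j t) * givens n i j t = 1\<^sub>m n" for t
    using assms by (simp add: givens_transpose givens_add givens_zero)
  have "det (transpose_mat (givens n i j (t/2))) * det (givens n i j (t/2)) = 1"
    using orth[of "t/2"] det_mult[of "transpose_mat (givens n i j (t/2))" n "givens n i j (t/2)"]
    by (simp add: givens_carrier)
  then have "det (givens n i j (t/2)) * det (givens n i j (t/2)) = 1"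
    by (simp add: det_transpose[OF givens_carrier])
  then have "det (givens n i j t) = 1"
    using det_mult[OF givens_carrier[of n i j "t/2"] givens_carrier[of n i j "t/2"]]
    by (simp add: givens_add[OF assms])
  then show ?thesis
    by (simp add: special_orthogonal_def givens_carrier orth)
qed

definition rotate_frame :: "nat \<Rightarrow> nat \<Rightarrow> nat \<Rightarrow> real \<Rightarrow> real vec \<times> real vec \<Rightarrow> real vec \<times> real vec" where
  "rotate_frame n i j t = map_prod ((*\<^sub>v) (givens n i j t)) ((*\<^sub>v) (givens n i j t))"

lemma rotate_frame_coords:
  assumes "z \<in> T_space n" "i < n" "j < n" "i \<noteq> j" "a < n"
  shows "xc a (rotate_frame n i j t z) = (if a = i then cos t * xc i z - sin t * xc j z
      else if a = j then sin t * xc i z + cos t * xc j z else xc a z)"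
    and "yc a (rotate_frame n i j t z) = (if a = i then cos t * yc i z - sin t * yc j z
      else if a = j then sin t * yc i z + cos t * yc j z else yc a z)"
  using assms by (simp_all add: rotate_frame_def T_space_coords givens_mult_vec xc_def yc_def)

lemma rotate_frame_T_space:
  assumes "z \<in> T_space n" "i < n" "j < n" "i \<noteq> j"
  shows "rotate_frame n i j t z \<in> T_space n"
proof -
  let ?Q = "givens n i j t"
  have "(?Q *\<^sub>v u) \<bullet> (?Q *\<^sub>v v) = u \<bullet> v" if "u \<in> carrier_vec n" "v \<in> carrier_vec n" for u v
  proof -
    have "(?Q *\<^sub>v u) \<bullet> (?Q *\<^sub>v v) = (transpose_mat ?Q *\<^sub>v (?Q *\<^sub>v u)) \<bullet> v"
      by (rule transpose_vec_mult_scalar[symmetric, OF givens_carrier that(2)])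
        (rule mult_mat_vec_carrier[OF givens_carrier that(1)])
    also have "transpose_mat ?Q *\<^sub>v (?Q *\<^sub>v u) = (transpose_mat ?Q * ?Q) *\<^sub>v u"
      using that givens_carrier[of n i j t] by (intro assoc_mult_mat_vec[symmetric]) auto
    also have "transpose_mat ?Q * ?Q = 1\<^sub>m n"
      using givens_special_orthogonal[OF assms(2-4)] by (simp add: special_orthogonal_def)
    finally show ?thesis using that by simp
  qed
  then show ?thesis using assms(1)
    by (auto simp: T_space_def rotate_frame_def intro!: mult_mat_vec_carrier givens_carrier)
qed

text \<open>
  \<open>T_borel\<close> is the coarsest structure making the pair of coordinate families measurable, and single
  coordinates are projections of that pair. The same universal property reduces the measurability of a
  rotation below to that of its coordinates.
\<close>

lemma coords_measurable:
  assumes "i < n"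
  shows "xc i \<in> borel_measurable (T_borel n)" "yc i \<in> borel_measurable (T_borel n)"
proof -
  let ?P = "\<Pi>\<^sub>M i \<in> {..<n}. (borel :: real measure)"
  have m: "map_prod (vec_coords n) (vec_coords n) \<in> measurable (T_borel n) (?P \<Otimes>\<^sub>M ?P)"
    unfolding T_borel_def
    by (rule measurable_vimage_algebra1) (auto simp: space_pair_measure space_PiM vec_coords_def)
  have "(\<lambda>z. fst (map_prod (vec_coords n) (vec_coords n) z) i) \<in> borel_measurable (T_borel n)"
    "(\<lambda>z. snd (map_prod (vec_coords n) (vec_coords n) z) i) \<in> borel_measurable (T_borel n)"
    using measurable_compose[OF measurable_compose[OF m measurable_fst] measurable_component_singleton, of i]
      measurable_compose[OF measurable_compose[OF m measurable_snd] measurable_component_singleton, of i]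
      assms by simp_all
  moreover have "(\<lambda>z. fst (map_prod (vec_coords n) (vec_coords n) z) i) = xc i"
    "(\<lambda>z. snd (map_prod (vec_coords n) (vec_coords n) z) i) = yc i"
    using assms by (auto simp: vec_coords_def xc_def yc_def)
  ultimately show "xc i \<in> borel_measurable (T_borel n)" "yc i \<in> borel_measurable (T_borel n)"
    by simp_all
qed

lemma space_T_borel: "space (T_borel n) = T_space n"
  by (simp add: T_borel_def)

lemma rotate_frame_measurable:
  assumes "i < n" "j < n" "i \<noteq> j"
  shows "rotate_frame n i j t \<in> measurable (T_borel n) (T_borel n)"
proof -
  let ?P = "\<Pi>\<^sub>M i \<in> {..<n}. (borel :: real measure)"
  have cm[measurable]: "(\<lambda>z. xc a (rotate_frame n i j t z)) \<in> borel_measurable (T_borel n)"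
    "(\<lambda>z. yc a (rotate_frame n i j t z)) \<in> borel_measurable (T_borel n)" if "a < n" for a
  proof -
    note [measurable] = coords_measurable[OF that] coords_measurable[OF assms(1)] coords_measurable[OF assms(2)]
    have "(\<lambda>z. if a = i then cos t * xc i z - sin t * xc j z
      else if a = j then sin t * xc i z + cos t * xc j z else xc a z) \<in> borel_measurable (T_borel n)"
      by simp
    then show "(\<lambda>z. xc a (rotate_frame n i j t z)) \<in> borel_measurable (T_borel n)"
      by (rule measurable_cong[THEN iffD1, rotated]) (simp add: rotate_frame_coords assms that space_T_borel)
    have "(\<lambda>z. if a = i then cos t * yc i z - sin t * yc j z
      else if a = j then sin t * yc i z + cos t * yc j z else yc a z) \<in> borel_measurable (T_borel n)"
      by simp
    then show "(\<lambda>z. yc a (rotate_frame n i j t z)) \<in> borel_measurable (T_borel n)"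
      by (rule measurable_cong[THEN iffD1, rotated]) (simp add: rotate_frame_coords assms that space_T_borel)
  qed
  have "(\<lambda>z. (\<lambda>a\<in>{..<n}. xc a (rotate_frame n i j t z), \<lambda>a\<in>{..<n}. yc a (rotate_frame n i j t z)))
      \<in> measurable (T_borel n) (?P \<Otimes>\<^sub>M ?P)"
    by (intro measurable_Pair measurable_restrict cm) auto
  moreover have "(\<lambda>z. map_prod (vec_coords n) (vec_coords n) (rotate_frame n i j t z)) =
      (\<lambda>z. (\<lambda>a\<in>{..<n}. xc a (rotate_frame n i j t z), \<lambda>a\<in>{..<n}. yc a (rotate_frame n i j t z)))"
    by (auto simp: vec_coords_def xc_def yc_def map_prod_def case_prod_unfold)
  ultimately have "(\<lambda>z. map_prod (vec_coords n) (vec_coords n) (rotate_frame n i j t z))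
      \<in> measurable (T_borel n) (?P \<Otimes>\<^sub>M ?P)" by simp
  then show ?thesis
    by (subst (2) T_borel_def) (rule measurable_vimage_algebra2,
        auto simp: space_T_borel rotate_frame_T_space assms)
qed

section \<open>Integration by parts for an invariant measure\<close>

text \<open>
  The moments are integrals of polynomials in the coordinates. The predicate keeps what makes them integrable with
  respect to any probability measure on \<open>T\<close>, in a form that is closed under ring operations.
\<close>

definition bounded_meas :: "nat \<Rightarrow> (real vec \<times> real vec \<Rightarrow> real) \<Rightarrow> bool" where
  "bounded_meas n f \<longleftrightarrow> f \<in> borel_measurable (T_borel n) \<and> (\<exists>B. \<forall>z \<in> T_space n. \<bar>f z\<bar> \<le> B)"

lemma bounded_meas_const: "bounded_meas n (\<lambda>z. c)"
  by (auto simp: bounded_meas_def)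

lemma bounded_meas_add:
  assumes "bounded_meas n f" "bounded_meas n g"
  shows "bounded_meas n (\<lambda>z. f z + g z)"
proof -
  obtain B C where "\<forall>z \<in> T_space n. \<bar>f z\<bar> \<le> B" "\<forall>z \<in> T_space n. \<bar>g z\<bar> \<le> C"
    using assms by (auto simp: bounded_meas_def)
  then have "\<forall>z \<in> T_space n. \<bar>f z + g z\<bar> \<le> B + C"
    by (meson abs_triangle_ineq add_mono order_trans)
  with assms show ?thesis by (auto simp: bounded_meas_def)
qed

lemma bounded_meas_mult:
  assumes "bounded_meas n f" "bounded_meas n g"
  shows "bounded_meas n (\<lambda>z. f z * g z)"
proof -
  obtain B C where "\<forall>z \<in> T_space n. \<bar>f z\<bar> \<le> B" "\<forall>z \<in> T_space n. \<bar>g z\<bar> \<le> C"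
    using assms by (auto simp: bounded_meas_def)
  then have "\<forall>z \<in> T_space n. \<bar>f z * g z\<bar> \<le> B * C"
    unfolding abs_mult by (intro ballI mult_mono) (auto intro: order_trans[OF abs_ge_zero])
  with assms show ?thesis by (auto simp: bounded_meas_def)
qed

lemma bounded_meas_diff:
  assumes "bounded_meas n f" "bounded_meas n g"
  shows "bounded_meas n (\<lambda>z. f z - g z)"
  using bounded_meas_add[OF assms(1) bounded_meas_mult[OF bounded_meas_const[of n "-1"] assms(2)]] by simp

lemma bounded_meas_sum:
  assumes "\<And>a. a \<in> S \<Longrightarrow> bounded_meas n (f a)"
  shows "bounded_meas n (\<lambda>z. \<Sum>a\<in>S. f a z)"
  using assms
  by (induction S rule: infinite_finite_induct) (auto intro: bounded_meas_const bounded_meas_add)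

lemma bounded_meas_power: "bounded_meas n f \<Longrightarrow> bounded_meas n (\<lambda>z. f z ^ k)"
  by (induction k) (auto intro: bounded_meas_const bounded_meas_mult)

lemma bounded_meas_coords:
  assumes "i < n"
  shows "bounded_meas n (xc i)" "bounded_meas n (yc i)"
proof -
  have le: "\<bar>u i\<bar> \<le> 1" if "(\<Sum>i<n. u i * u i) = 1" for u :: "nat \<Rightarrow> real"
  proof -
    have "u i * u i \<le> (\<Sum>i<n. u i * u i)"
      using assms by (intro member_le_sum) auto
    then have "(u i)\<^sup>2 \<le> 1" using that by (simp add: power2_eq_square)
    then show ?thesis by (simp add: abs_square_le_1)
  qed
  have "\<bar>xc i z\<bar> \<le> 1" "\<bar>yc i z\<bar> \<le> 1" if "z \<in> T_space n" for z
    using that le[of "\<lambda>i. xc i z"] le[of "\<lambda>i. yc i z"] by (auto simp: T_space_coords)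
  then show "bounded_meas n (xc i)" "bounded_meas n (yc i)"
    using coords_measurable[OF assms] unfolding bounded_meas_def by blast+
qed

lemmas bounded_meas_intros = bounded_meas_const bounded_meas_add bounded_meas_mult bounded_meas_diff
  bounded_meas_sum bounded_meas_power bounded_meas_coords

text \<open>
  The families \<open>fx\<close> and \<open>fy\<close> are the partial derivatives of a polynomial function in the variables
  \<open>x\<^sub>k\<close> and \<open>y\<^sub>k\<close>. The chain rule along curves stands for differentiability, which avoids a topology on
  the space of pairs and is exactly what rotations require. Listing the partial derivatives as functions
  allows Euler's relation for homogeneous polynomials to be stated as an identity off \<open>T\<close>.
\<close>

definition has_grad :: "nat \<Rightarrow> (real vec \<times> real vec \<Rightarrow> real) \<Rightarrow>
    (nat \<Rightarrow> real vec \<times> real vec \<Rightarrow> real) \<Rightarrow> (nat \<Rightarrow> real vec \<times> real vec \<Rightarrow> real) \<Rightarrow> bool" where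
  "has_grad n f fx fy \<longleftrightarrow> bounded_meas n f \<and> (\<forall>k<n. bounded_meas n (fx k) \<and> bounded_meas n (fy k)) \<and>
     (\<forall>c c' d' t. (\<forall>k<n. ((\<lambda>s. xc k (c s)) has_real_derivative c' k) (at t) \<and>
         ((\<lambda>s. yc k (c s)) has_real_derivative d' k) (at t)) \<longrightarrow>
       ((\<lambda>s. f (c s)) has_real_derivative (\<Sum>k<n. fx k (c t) * c' k + fy k (c t) * d' k)) (at t))"

lemma has_grad_bounded_meas: "has_grad n f fx fy \<Longrightarrow> bounded_meas n f"
  "has_grad n f fx fy \<Longrightarrow> k < n \<Longrightarrow> bounded_meas n (fx k)"
  "has_grad n f fx fy \<Longrightarrow> k < n \<Longrightarrow> bounded_meas n (fy k)"
  by (auto simp: has_grad_def)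

lemma has_grad_chain:
  assumes "has_grad n f fx fy"
    and "\<And>k. k < n \<Longrightarrow> ((\<lambda>s. xc k (c s)) has_real_derivative c' k) (at t)"
    and "\<And>k. k < n \<Longrightarrow> ((\<lambda>s. yc k (c s)) has_real_derivative d' k) (at t)"
  shows "((\<lambda>s. f (c s)) has_real_derivative (\<Sum>k<n. fx k (c t) * c' k + fy k (c t) * d' k)) (at t)"
  using assms unfolding has_grad_def by blast

lemma has_grad_cong:
  assumes "has_grad n f fx fy" "\<And>z. f' z = f z"
    "\<And>k z. k < n \<Longrightarrow> fx' k z = fx k z" "\<And>k z. k < n \<Longrightarrow> fy' k z = fy k z"
  shows "has_grad n f' fx' fy'"
proof -
  have "f' = f" "\<And>k. k < n \<Longrightarrow> fx' k = fx k" "\<And>k. k < n \<Longrightarrow> fy' k = fy k"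
    using assms(2-) by auto
  with assms(1) show ?thesis by (simp add: has_grad_def)
qed

lemma has_grad_const: "has_grad n (\<lambda>z. c) (\<lambda>k z. 0) (\<lambda>k z. 0)"
  by (simp add: has_grad_def bounded_meas_const)

lemma has_grad_xc: "i < n \<Longrightarrow> has_grad n (xc i) (\<lambda>k z. if k = i then 1 else 0) (\<lambda>k z. 0)"
  by (auto simp: has_grad_def bounded_meas_const bounded_meas_coords if_distrib[of "\<lambda>u. u * _"] cong: if_cong)

lemma has_grad_yc: "i < n \<Longrightarrow> has_grad n (yc i) (\<lambda>k z. 0) (\<lambda>k z. if k = i then 1 else 0)"
  by (auto simp: has_grad_def bounded_meas_const bounded_meas_coords if_distrib[of "\<lambda>u. u * _"] cong: if_cong)

lemma has_grad_add:
  assumes "has_grad n f fx fy" "has_grad n g gx gy"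
  shows "has_grad n (\<lambda>z. f z + g z) (\<lambda>k z. fx k z + gx k z) (\<lambda>k z. fy k z + gy k z)"
  unfolding has_grad_def
proof (intro conjI allI impI)
  fix c c' d' t
  assume "\<forall>k<n. ((\<lambda>s. xc k (c s)) has_real_derivative c' k) (at t) \<and>
         ((\<lambda>s. yc k (c s)) has_real_derivative d' k) (at t)"
  then have c: "k < n \<Longrightarrow> ((\<lambda>s. xc k (c s)) has_real_derivative c' k) (at t)"
    "k < n \<Longrightarrow> ((\<lambda>s. yc k (c s)) has_real_derivative d' k) (at t)" for k
    by auto
  from DERIV_add[OF has_grad_chain[OF assms(1) c] has_grad_chain[OF assms(2) c]]
  show "((\<lambda>s. f (c s) + g (c s)) has_real_derivative
      (\<Sum>k<n. (fx k (c t) + gx k (c t)) * c' k + (fy k (c t) + gy k (c t)) * d' k)) (at t)"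
    by (rule DERIV_cong) (simp_all add: sum.distrib algebra_simps)
qed (intro bounded_meas_intros has_grad_bounded_meas[OF assms(1)] has_grad_bounded_meas[OF assms(2)]; assumption)+

lemma has_grad_mult:
  assumes "has_grad n f fx fy" "has_grad n g gx gy"
  shows "has_grad n (\<lambda>z. f z * g z) (\<lambda>k z. fx k z * g z + f z * gx k z) (\<lambda>k z. fy k z * g z + f z * gy k z)"
  unfolding has_grad_def
proof (intro conjI allI impI)
  fix c c' d' t
  assume "\<forall>k<n. ((\<lambda>s. xc k (c s)) has_real_derivative c' k) (at t) \<and>
         ((\<lambda>s. yc k (c s)) has_real_derivative d' k) (at t)"
  then have c: "k < n \<Longrightarrow> ((\<lambda>s. xc k (c s)) has_real_derivative c' k) (at t)"
    "k < n \<Longrightarrow> ((\<lambda>s. yc k (c s)) has_real_derivative d' k) (at t)" for k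
    by auto
  from DERIV_mult[OF has_grad_chain[OF assms(1) c] has_grad_chain[OF assms(2) c]]
  show "((\<lambda>s. f (c s) * g (c s)) has_real_derivative
      (\<Sum>k<n. (fx k (c t) * g (c t) + f (c t) * gx k (c t)) * c' k +
        (fy k (c t) * g (c t) + f (c t) * gy k (c t)) * d' k)) (at t)"
    by (rule DERIV_cong) (simp_all add: sum.distrib sum_distrib_left sum_distrib_right algebra_simps)
qed (intro bounded_meas_intros has_grad_bounded_meas[OF assms(1)] has_grad_bounded_meas[OF assms(2)]; assumption)+

lemma has_grad_sum:
  assumes "\<And>a. a \<in> S \<Longrightarrow> has_grad n (f a) (fx a) (fy a)"
  shows "has_grad n (\<lambda>z. \<Sum>a\<in>S. f a z) (\<lambda>k z. \<Sum>a\<in>S. fx a k z) (\<lambda>k z. \<Sum>a\<in>S. fy a k z)"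
  using assms
  by (induction S rule: infinite_finite_induct) (auto intro: has_grad_const has_grad_add)

lemma integral_double_sum:
  fixes f :: "nat \<Rightarrow> nat \<Rightarrow> 'a \<Rightarrow> real"
  assumes "\<And>i j. i < n \<Longrightarrow> j < n \<Longrightarrow> integrable M (f i j)"
  shows "(\<Sum>i<n. \<Sum>j<n. \<integral>z. f i j z \<partial>M) = (\<integral>z. (\<Sum>i<n. \<Sum>j<n. f i j z) \<partial>M)"
proof -
  have "(\<integral>z. (\<Sum>i<n. \<Sum>j<n. f i j z) \<partial>M) = (\<Sum>i<n. \<integral>z. (\<Sum>j<n. f i j z) \<partial>M)"
    using assms by (intro Bochner_Integration.integral_sum Bochner_Integration.integrable_sum) auto
  also have "\<dots> = (\<Sum>i<n. \<Sum>j<n. \<integral>z. f i j z \<partial>M)"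
    using assms by (intro sum.cong refl Bochner_Integration.integral_sum) auto
  finally show ?thesis by simp
qed

locale frame_measure =
  fixes n :: nat and M :: "(real vec \<times> real vec) measure"
  assumes invariant: "invariant_prob_T n M" and dim: "3 \<le> n"
begin

lemma sets_M: "sets M = sets (T_borel n)" and space_M: "space M = T_space n"
  and prob_M: "prob_space M"
  using invariant by (auto simp: invariant_prob_T_def)

lemma integrable_bounded_meas:
  assumes "bounded_meas n f"
  shows "integrable M f"
proof -
  interpret prob_space M by (rule prob_M)
  obtain B where "\<And>z. z \<in> space M \<Longrightarrow> norm (f z) \<le> B"
    using assms by (auto simp: bounded_meas_def space_M)
  moreover have "f \<in> borel_measurable M"
    using assms by (simp add: bounded_meas_def measurable_cong_sets[OF sets_M refl])
  ultimately show ?thesis by (intro integrable_const_bound[of _ B]) auto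
qed

lemma integral_rotate_frame:
  assumes "bounded_meas n f" "i < n" "j < n" "i \<noteq> j"
  shows "(\<integral>z. f (rotate_frame n i j t z) \<partial>M) = (\<integral>z. f z \<partial>M)"
proof -
  have r: "rotate_frame n i j t \<in> measurable M M"
    using rotate_frame_measurable[OF assms(2-)] by (simp add: measurable_cong_sets[OF sets_M sets_M])
  have "f \<in> borel_measurable M"
    using assms by (simp add: bounded_meas_def measurable_cong_sets[OF sets_M refl])
  then have "(\<integral>z. f (rotate_frame n i j t z) \<partial>M) = (\<integral>z. f z \<partial>(distr M M (rotate_frame n i j t)))"
    by (rule integral_distr[OF r, symmetric])
  also have "distr M M (rotate_frame n i j t) = M"
    using invariant givens_special_orthogonal[OF assms(2-)]
    by (auto simp: invariant_prob_T_def rotate_frame_def)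
  finally show ?thesis .
qed

text \<open>
  The integral of \<open>f\<close> over the rotated frame does not depend on the angle, and the integrand here is its
  derivative at angle 0. The derivative at any other angle is the same expression at the rotated point,
  so the mean value theorem bounds all difference quotients by the maximum of that expression on \<open>T\<close>, and
  dominated convergence exchanges limit and integral.
\<close>

lemma integral_rotation_derivative:
  assumes f: "has_grad n f fx fy" and ij: "i < n" "j < n"
  shows "(\<integral>z. xc i z * fx j z - xc j z * fx i z + (yc i z * fy j z - yc j z * fy i z) \<partial>M) = 0"
proof (cases "i = j")
  case False
  let ?L = "\<lambda>z. xc i z * fx j z - xc j z * fx i z + (yc i z * fy j z - yc j z * fy i z)"
  let ?R = "rotate_frame n i j"
  have bm: "bounded_meas n ?L"
    by (intro bounded_meas_diff bounded_meas_add bounded_meas_mult bounded_meas_coords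
        has_grad_bounded_meas(2,3)[OF f] ij)
  then obtain B where B: "\<And>z. z \<in> T_space n \<Longrightarrow> \<bar>?L z\<bar> \<le> B"
    by (auto simp: bounded_meas_def)
  have der: "((\<lambda>t. f (?R t z)) has_real_derivative ?L (?R t z)) (at t)" if z: "z \<in> T_space n" for z t
  proof -
    have "((\<lambda>t. f (?R t z)) has_real_derivative
      (\<Sum>k<n. fx k (?R t z) * (if k = i then - xc j (?R t z) else if k = j then xc i (?R t z) else 0) +
        fy k (?R t z) * (if k = i then - yc j (?R t z) else if k = j then yc i (?R t z) else 0))) (at t)"
      using False ij z
      by (intro has_grad_chain[OF f])
        (auto simp: rotate_frame_coords intro!: derivative_eq_intros)
    moreover have "(\<Sum>k<n. fx k w * (if k = i then - xc j w else if k = j then xc i w else 0) +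
        fy k w * (if k = i then - yc j w else if k = j then yc i w else 0)) = ?L w" for w
    proof -
      have "(\<Sum>k<n. fx k w * (if k = i then - xc j w else if k = j then xc i w else 0) +
        fy k w * (if k = i then - yc j w else if k = j then yc i w else 0)) =
        (\<Sum>k<n. (if k = i then - fx i w * xc j w - fy i w * yc j w else 0) +
           (if k = j then fx j w * xc i w + fy j w * yc i w else 0))"
        using False by (intro sum.cong) auto
      also have "\<dots> = ?L w" using ij by (simp add: sum.distrib algebra_simps)
      finally show ?thesis .
    qed
    ultimately show ?thesis by simp
  qed
  have zero: "?R 0 z = z" if "z \<in> T_space n" for z
    using that False by (auto simp: rotate_frame_def givens_zero T_space_def map_prod_def)
  let ?s = "\<lambda>m z. (f (?R (1 / real (Suc m)) z) - f z) / (1 / real (Suc m))"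
  have to0: "filterlim (\<lambda>m. 1 / real (Suc m)) (at 0) sequentially"
    unfolding filterlim_at using LIMSEQ_Suc[OF lim_1_over_n] by (auto simp: eventually_sequentially)
  have conv: "(\<lambda>m. ?s m z) \<longlonglongrightarrow> ?L z" if z: "z \<in> T_space n" for z
  proof -
    have "((\<lambda>h. (f (?R h z) - f z) / h) \<longlongrightarrow> ?L z) (at 0)"
      using der[OF z, of 0] by (simp add: DERIV_def zero[OF z])
    from filterlim_compose[OF this to0] show ?thesis .
  qed
  have bound: "\<bar>?s m z\<bar> \<le> B" if z: "z \<in> T_space n" for m z
  proof -
    obtain \<xi> where "f (?R (1 / real (Suc m)) z) - f (?R 0 z) = (1 / real (Suc m) - 0) * ?L (?R \<xi> z)"
      using MVT2[of 0 "1 / real (Suc m)", OF _ der[OF z]] by auto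
    then have "?s m z = ?L (?R \<xi> z)" by (simp add: zero[OF z] field_simps)
    then show ?thesis using B[OF rotate_frame_T_space[OF z ij False]] by simp
  qed
  have fr: "integrable M (\<lambda>z. f (?R t z))" for t
  proof (rule integrable_bounded_meas)
    obtain C where "\<And>z. z \<in> T_space n \<Longrightarrow> \<bar>f z\<bar> \<le> C" and "f \<in> borel_measurable (T_borel n)"
      using has_grad_bounded_meas(1)[OF f] by (auto simp: bounded_meas_def)
    then show "bounded_meas n (\<lambda>z. f (?R t z))"
      using rotate_frame_T_space ij False measurable_compose[OF rotate_frame_measurable[OF ij False]]
      unfolding bounded_meas_def by blast
  qed
  have fi: "integrable M f" using f by (intro integrable_bounded_meas has_grad_bounded_meas)
  have int0: "(\<integral>z. ?s m z \<partial>M) = 0" for m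
    using fr fi integral_rotate_frame[OF has_grad_bounded_meas(1)[OF f] ij False] by simp
  interpret prob_space M by (rule prob_M)
  have "(\<lambda>m. \<integral>z. ?s m z \<partial>M) \<longlonglongrightarrow> (\<integral>z. ?L z \<partial>M)"
  proof (rule integral_dominated_convergence[where w = "\<lambda>_. B"])
    show "?L \<in> borel_measurable M"
      using integrable_bounded_meas[OF bm] by (rule borel_measurable_integrable)
    show "?s m \<in> borel_measurable M" for m
      using fr[of "1 / real (Suc m)"] fi by (auto intro!: borel_measurable_integrable)
  qed (use conv bound in \<open>auto simp: space_M\<close>)
  then have "(\<lambda>m. 0) \<longlonglongrightarrow> (\<integral>z. ?L z \<partial>M)" by (simp only: int0)
  then show ?thesis by (simp add: LIMSEQ_const_iff)
qed simp

text \<open>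
  Sum the vanishing integrals of \<open>L\<^sub>i\<^sub>j (u\<^sub>i F\<^sub>j)\<close> over all \<open>i, j\<close>. Differentiating \<open>u\<^sub>i\<close> contributes
  \<open>- (n - 1) \<langle>u, F\<rangle>\<close>; in the terms \<open>u\<^sub>i L\<^sub>i\<^sub>j F\<^sub>j\<close> the relations \<open>\<langle>u, x\<rangle> = \<alpha>\<close> and \<open>\<langle>u, y\<rangle> = \<beta>\<close> on \<open>T\<close>
  produce the divergence, and what remains is the derivative of \<open>F\<close> in direction \<open>u\<close>, paired with the
  frame. The parameters cover \<open>u = x\<close> and \<open>u = y\<close> by one computation.
\<close>

lemma divergence_identity:
  fixes \<alpha> \<beta> :: real
  defines "u \<equiv> \<lambda>i z. \<alpha> * xc i z + \<beta> * yc i z"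
  assumes F: "\<And>j. j < n \<Longrightarrow> has_grad n (F j) (Fx j) (Fy j)"
  shows "real (n - 1) * (\<integral>z. (\<Sum>j<n. u j z * F j z) \<partial>M) =
    (\<integral>z. (\<Sum>j<n. \<alpha> * Fx j j z + \<beta> * Fy j j z) - (\<Sum>j<n. xc j z * (\<Sum>i<n. u i z * Fx j i z))
       - (\<Sum>j<n. yc j z * (\<Sum>i<n. u i z * Fy j i z)) \<partial>M)"
proof -
  let ?gx = "\<lambda>i j k z. (if k = i then \<alpha> else 0) * F j z + u i z * Fx j k z"
  let ?gy = "\<lambda>i j k z. (if k = i then \<beta> else 0) * F j z + u i z * Fy j k z"
  let ?L = "\<lambda>i j z. xc i z * ?gx i j j z - xc j z * ?gx i j i z + (yc i z * ?gy i j j z - yc j z * ?gy i j i z)"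
  have u: "has_grad n (u i) (\<lambda>k z. if k = i then \<alpha> else 0) (\<lambda>k z. if k = i then \<beta> else 0)" if "i < n" for i
    unfolding u_def
    by (rule has_grad_cong[OF has_grad_add[OF has_grad_mult[OF has_grad_const has_grad_xc[OF that]]
      has_grad_mult[OF has_grad_const has_grad_yc[OF that]]]]) auto
  have g: "has_grad n (\<lambda>z. u i z * F j z) (?gx i j) (?gy i j)" if "i < n" "j < n" for i j
    by (rule has_grad_mult[OF u[OF that(1)] F[OF that(2)]])
  have Lbm: "bounded_meas n (?L i j)" if "i < n" "j < n" for i j
    using that g[OF that] by (intro bounded_meas_diff bounded_meas_add bounded_meas_mult[OF bounded_meas_coords(1)]
      bounded_meas_mult[OF bounded_meas_coords(2)] has_grad_bounded_meas(2)[OF g] has_grad_bounded_meas(3)[OF g])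
  note u_bm = has_grad_bounded_meas(1)[OF u]
  note F_bm = has_grad_bounded_meas[OF F]
  let ?lhs = "\<lambda>z. \<Sum>j<n. u j z * F j z"
  let ?rhs = "\<lambda>z. (\<Sum>j<n. \<alpha> * Fx j j z + \<beta> * Fy j j z) - (\<Sum>j<n. xc j z * (\<Sum>i<n. u i z * Fx j i z))
       - (\<Sum>j<n. yc j z * (\<Sum>i<n. u i z * Fy j i z))"
  have lhs: "integrable M ?lhs"
    by (intro integrable_bounded_meas bounded_meas_intros u_bm F_bm) auto
  have rhs: "integrable M ?rhs"
    by (intro integrable_bounded_meas bounded_meas_intros u_bm F_bm) auto
  have pt: "(\<Sum>i<n. \<Sum>j<n. ?L i j z) = ?rhs z - real (n - 1) * ?lhs z" if z: "z \<in> T_space n" for z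
  proof -
    have ux: "(\<Sum>i<n. u i z * xc i z) = \<alpha>"
    proof -
      have "(\<Sum>i<n. u i z * xc i z) = \<alpha> * (\<Sum>i<n. xc i z * xc i z) + \<beta> * (\<Sum>i<n. xc i z * yc i z)"
        by (simp add: u_def sum.distrib sum_distrib_left algebra_simps)
      then show ?thesis using z by (simp add: T_space_coords)
    qed
    have uy: "(\<Sum>i<n. u i z * yc i z) = \<beta>"
    proof -
      have "(\<Sum>i<n. u i z * yc i z) = \<alpha> * (\<Sum>i<n. xc i z * yc i z) + \<beta> * (\<Sum>i<n. yc i z * yc i z)"
        by (simp add: u_def sum.distrib sum_distrib_left algebra_simps)
      then show ?thesis using z by (simp add: T_space_coords)
    qed
    have "(\<Sum>i<n. \<Sum>j<n. ?L i j z) = (\<Sum>i<n. \<Sum>j<n. (if j = i then u j z * F j z else 0) - u j z * F j z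
        + (u i z * xc i z) * Fx j j z + (u i z * yc i z) * Fy j j z
        - xc j z * (u i z * Fx j i z) - yc j z * (u i z * Fy j i z))"
      by (intro sum.cong refl) (auto simp: u_def algebra_simps)
    also have "\<dots> = ?lhs z - real n * ?lhs z + (\<Sum>i<n. u i z * xc i z) * (\<Sum>j<n. Fx j j z)
        + (\<Sum>i<n. u i z * yc i z) * (\<Sum>j<n. Fy j j z)
        - (\<Sum>i<n. \<Sum>j<n. xc j z * (u i z * Fx j i z)) - (\<Sum>i<n. \<Sum>j<n. yc j z * (u i z * Fy j i z))"
      by (simp add: sum.distrib sum_subtractf sum_product)
    also have "(\<Sum>i<n. \<Sum>j<n. xc j z * (u i z * Fx j i z)) = (\<Sum>j<n. xc j z * (\<Sum>i<n. u i z * Fx j i z))"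
      by (subst sum.swap) (simp add: sum_distrib_left)
    also have "(\<Sum>i<n. \<Sum>j<n. yc j z * (u i z * Fy j i z)) = (\<Sum>j<n. yc j z * (\<Sum>i<n. u i z * Fy j i z))"
      by (subst sum.swap) (simp add: sum_distrib_left)
    finally have e: "(\<Sum>i<n. \<Sum>j<n. ?L i j z) = ?lhs z - real n * ?lhs z + \<alpha> * (\<Sum>j<n. Fx j j z)
        + \<beta> * (\<Sum>j<n. Fy j j z) - (\<Sum>j<n. xc j z * (\<Sum>i<n. u i z * Fx j i z))
        - (\<Sum>j<n. yc j z * (\<Sum>i<n. u i z * Fy j i z))"
      unfolding ux uy .
    have "(\<Sum>j<n. \<alpha> * Fx j j z + \<beta> * Fy j j z) = \<alpha> * (\<Sum>j<n. Fx j j z) + \<beta> * (\<Sum>j<n. Fy j j z)"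
      by (simp add: sum.distrib sum_distrib_left)
    moreover have "real (n - 1) = real n - 1" using dim by (simp add: of_nat_diff)
    ultimately show ?thesis unfolding e by (simp add: left_diff_distrib)
  qed
  have "0 = (\<Sum>i<n. \<Sum>j<n. \<integral>z. ?L i j z \<partial>M)"
    by (intro sum.neutral[symmetric] sum.neutral ballI integral_rotation_derivative[OF g]) auto
  also have "\<dots> = (\<integral>z. (\<Sum>i<n. \<Sum>j<n. ?L i j z) \<partial>M)"
    by (rule integral_double_sum[OF integrable_bounded_meas[OF Lbm]])
  also have "\<dots> = (\<integral>z. ?rhs z - real (n - 1) * ?lhs z \<partial>M)"
    by (intro Bochner_Integration.integral_cong refl pt) (simp add: space_M)
  also have "\<dots> = (\<integral>z. ?rhs z \<partial>M) - real (n - 1) * (\<integral>z. ?lhs z \<partial>M)"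
    using lhs rhs by simp
  finally show ?thesis by simp
qed

end

section \<open>Reduction to the two spheres\<close>

text \<open>
  Matrices are functions of two indices, of which only the values below \<open>n\<close> matter. They act on the
  component \<open>x\<close> of a point of \<open>T\<close>.
\<close>

definition mat_vec :: "nat \<Rightarrow> (nat \<Rightarrow> nat \<Rightarrow> real) \<Rightarrow> nat \<Rightarrow> real vec \<times> real vec \<Rightarrow> real" where
  "mat_vec n A i z = (\<Sum>j<n. A i j * xc j z)"

definition quad_form :: "nat \<Rightarrow> (nat \<Rightarrow> nat \<Rightarrow> real) \<Rightarrow> real vec \<times> real vec \<Rightarrow> real" where
  "quad_form n A z = (\<Sum>i<n. xc i z * mat_vec n A i z)"

definition mat_trace :: "nat \<Rightarrow> (nat \<Rightarrow> nat \<Rightarrow> real) \<Rightarrow> real" where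
  "mat_trace n A = (\<Sum>i<n. A i i)"

definition frobenius :: "nat \<Rightarrow> (nat \<Rightarrow> nat \<Rightarrow> real) \<Rightarrow> (nat \<Rightarrow> nat \<Rightarrow> real) \<Rightarrow> real" where
  "frobenius n A B = (\<Sum>i<n. \<Sum>j<n. A i j * B i j)"

definition mat_prod :: "nat \<Rightarrow> (nat \<Rightarrow> nat \<Rightarrow> real) \<Rightarrow> (nat \<Rightarrow> nat \<Rightarrow> real) \<Rightarrow> nat \<Rightarrow> nat \<Rightarrow> real" where
  "mat_prod n A B i j = (\<Sum>k<n. A i k * B k j)"

definition symmetric_on :: "nat \<Rightarrow> (nat \<Rightarrow> nat \<Rightarrow> real) \<Rightarrow> bool" where
  "symmetric_on n A \<longleftrightarrow> (\<forall>i<n. \<forall>j<n. A i j = A j i)"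

definition skew_on :: "nat \<Rightarrow> (nat \<Rightarrow> nat \<Rightarrow> real) \<Rightarrow> bool" where
  "skew_on n A \<longleftrightarrow> (\<forall>i<n. \<forall>j<n. A i j = - A j i)"

lemma bilin_eq_inner: "bilin n A z = (\<Sum>j<n. yc j z * mat_vec n (\<lambda>i j. A j i) j z)"
  unfolding bilin_def by (subst sum.swap) (simp add: mat_vec_def sum_distrib_left mult_ac)

lemma inner_mat_vec:
  "(\<Sum>j<n. mat_vec n A j z * mat_vec n B j z) = quad_form n (mat_prod n (\<lambda>i j. A j i) B) z"
proof -
  have "(\<Sum>j<n. mat_vec n A j z * mat_vec n B j z) = (\<Sum>j<n. \<Sum>i<n. \<Sum>k<n. A j i * xc i z * (B j k * xc k z))"
    by (simp add: mat_vec_def sum_product)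
  also have "\<dots> = (\<Sum>i<n. \<Sum>j<n. \<Sum>k<n. A j i * xc i z * (B j k * xc k z))"
    by (rule sum.swap)
  also have "\<dots> = (\<Sum>i<n. \<Sum>k<n. \<Sum>j<n. A j i * xc i z * (B j k * xc k z))"
    by (intro sum.cong refl sum.swap)
  also have "\<dots> = quad_form n (mat_prod n (\<lambda>i j. A j i) B) z"
    by (simp add: quad_form_def mat_vec_def mat_prod_def sum_distrib_left sum_distrib_right mult_ac)
  finally show ?thesis .
qed

lemma trace_mmul_transpose: "mat_trace n (mat_prod n (\<lambda>i j. A j i) B) = frobenius n A B"
  unfolding mat_trace_def mat_prod_def frobenius_def by (rule sum.swap)

lemma has_grad_mat_vec: "has_grad n (mat_vec n A i) (\<lambda>k z. A i k) (\<lambda>k z. 0)"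
  unfolding mat_vec_def
  by (rule has_grad_cong[OF has_grad_sum[where S = "{..<n}", OF has_grad_mult[OF has_grad_const has_grad_xc]]])
    (auto simp: if_distrib[of "\<lambda>u. _ * u"] cong: if_cong)

lemma has_grad_quad:
  assumes "symmetric_on n A"
  shows "has_grad n (quad_form n A) (\<lambda>k z. 2 * mat_vec n A k z) (\<lambda>k z. 0)"
  unfolding quad_form_def
proof (rule has_grad_cong[OF has_grad_sum[where S = "{..<n}", OF has_grad_mult[OF has_grad_xc has_grad_mat_vec]]])
  fix k z assume k: "k < n"
  have "(\<Sum>i<n. xc i z * A i k) = mat_vec n A k z"
    unfolding mat_vec_def using assms k by (intro sum.cong) (auto simp: symmetric_on_def)
  then show "2 * mat_vec n A k z = (\<Sum>i<n. (if k = i then 1 else 0) * mat_vec n A i z + xc i z * A i k)"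
    using k by (simp add: sum.distrib if_distrib[of "\<lambda>u. u * _"] cong: if_cong)
qed auto

text \<open>
  A polynomial field \<open>a(x)\<close> with \<open>\<langle>x, a(x)\<rangle> = 0\<close>. The last condition is the derivative of this identity
  with respect to \<open>x\<^sub>i\<close>; it holds as soon as the identity holds on all of \<open>\<real>\<^sup>n\<close>, and its restriction to
  \<open>T\<close> is the form that integration by parts consumes.
\<close>

definition tangent_field :: "nat \<Rightarrow> (nat \<Rightarrow> real vec \<times> real vec \<Rightarrow> real) \<Rightarrow>
    (nat \<Rightarrow> nat \<Rightarrow> real vec \<times> real vec \<Rightarrow> real) \<Rightarrow> bool" where
  "tangent_field n a ax \<longleftrightarrow> (\<forall>j<n. has_grad n (a j) (ax j) (\<lambda>k z. 0)) \<and>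
     (\<forall>z \<in> T_space n. (\<Sum>j<n. xc j z * a j z) = 0 \<and>
        (\<forall>i<n. (\<Sum>j<n. xc j z * ax j i z) = - a i z))"

context frame_measure
begin

text \<open>
  Integration by parts on the unit sphere for the field \<open>f(x) A x\<close>. Its divergence is
  \<open>tr A f + \<langle>A x, grad f\<rangle>\<close>; its radial derivative, paired with \<open>x\<close>, is \<open>(1 + d) \<langle>x, A x\<rangle> f\<close> by Euler's
  relation, because the field is homogeneous of degree \<open>1 + d\<close>.
\<close>

lemma integral_quad_mult:
  assumes f: "has_grad n f fx (\<lambda>k z. 0)" and euler: "\<And>z. (\<Sum>i<n. xc i z * fx i z) = d * f z"
  shows "(real n + d) * (\<integral>z. quad_form n A z * f z \<partial>M) =
    (\<integral>z. mat_trace n A * f z + (\<Sum>j<n. mat_vec n A j z * fx j z) \<partial>M)"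
proof -
  let ?q = "\<lambda>z. quad_form n A z * f z" and ?r = "\<lambda>z. mat_trace n A * f z + (\<Sum>j<n. mat_vec n A j z * fx j z)"
  note bm = bounded_meas_intros has_grad_bounded_meas(1)[OF f] has_grad_bounded_meas(1)[OF has_grad_mat_vec]
      has_grad_bounded_meas(2)[OF f]
  have q: "integrable M ?q"
    unfolding quad_form_def by (intro integrable_bounded_meas bm) auto
  have r: "integrable M ?r"
    by (intro integrable_bounded_meas bm) auto
  \<comment> \<open>The divergence identity at \<open>u = x\<close>; the zeros are \<open>\<beta>\<close> and the derivatives in \<open>y\<close> of a field in \<open>x\<close>.\<close>
  have "real (n - 1) * (\<integral>z. (\<Sum>j<n. (1 * xc j z + 0 * yc j z) * (mat_vec n A j z * f z)) \<partial>M) =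
    (\<integral>z. (\<Sum>j<n. 1 * (A j j * f z + mat_vec n A j z * fx j z) + 0 * (0 * f z + mat_vec n A j z * 0))
       - (\<Sum>j<n. xc j z * (\<Sum>i<n. (1 * xc i z + 0 * yc i z) * (A j i * f z + mat_vec n A j z * fx i z)))
       - (\<Sum>j<n. yc j z * (\<Sum>i<n. (1 * xc i z + 0 * yc i z) * (0 * f z + mat_vec n A j z * 0))) \<partial>M)"
    by (rule divergence_identity[OF has_grad_mult[OF has_grad_mat_vec f]])
  also have "(\<lambda>z. \<Sum>j<n. (1 * xc j z + 0 * yc j z) * (mat_vec n A j z * f z)) = ?q"
    by (simp add: quad_form_def sum_distrib_right mult.assoc)
  also have "(\<lambda>z. (\<Sum>j<n. 1 * (A j j * f z + mat_vec n A j z * fx j z) + 0 * (0 * f z + mat_vec n A j z * 0))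
       - (\<Sum>j<n. xc j z * (\<Sum>i<n. (1 * xc i z + 0 * yc i z) * (A j i * f z + mat_vec n A j z * fx i z)))
       - (\<Sum>j<n. yc j z * (\<Sum>i<n. (1 * xc i z + 0 * yc i z) * (0 * f z + mat_vec n A j z * 0)))) =
      (\<lambda>z. ?r z - (1 + d) * ?q z)"
  proof
    fix z
    have "(\<Sum>i<n. xc i z * (A j i * f z + mat_vec n A j z * fx i z)) = (1 + d) * mat_vec n A j z * f z" for j
    proof -
      have "(\<Sum>i<n. xc i z * (A j i * f z + mat_vec n A j z * fx i z)) =
          mat_vec n A j z * f z + mat_vec n A j z * (\<Sum>i<n. xc i z * fx i z)"
        by (simp add: mat_vec_def sum.distrib sum_distrib_left sum_distrib_right algebra_simps)
      then show ?thesis by (simp add: euler algebra_simps)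
    qed
    then have "(\<Sum>j<n. xc j z * (\<Sum>i<n. xc i z * (A j i * f z + mat_vec n A j z * fx i z))) = (1 + d) * ?q z"
      by (simp add: quad_form_def sum_distrib_left sum_distrib_right mult_ac)
    moreover have "(\<Sum>j<n. A j j * f z + mat_vec n A j z * fx j z) = ?r z"
      by (simp add: mat_trace_def sum.distrib sum_distrib_right)
    ultimately show "(\<Sum>j<n. 1 * (A j j * f z + mat_vec n A j z * fx j z) + 0 * (0 * f z + mat_vec n A j z * 0))
       - (\<Sum>j<n. xc j z * (\<Sum>i<n. (1 * xc i z + 0 * yc i z) * (A j i * f z + mat_vec n A j z * fx i z)))
       - (\<Sum>j<n. yc j z * (\<Sum>i<n. (1 * xc i z + 0 * yc i z) * (0 * f z + mat_vec n A j z * 0))) =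
       ?r z - (1 + d) * ?q z"
      by simp
  qed
  finally have "real (n - 1) * (\<integral>z. ?q z \<partial>M) = (\<integral>z. ?r z \<partial>M) - (1 + d) * (\<integral>z. ?q z \<partial>M)"
    using q r by simp
  moreover have "real (n - 1) = real n - 1" using dim by (simp add: of_nat_diff)
  ultimately show ?thesis by (simp add: algebra_simps)
qed

text \<open>
  Integration by parts over \<open>y\<close> in the unit sphere of the hyperplane orthogonal to \<open>x\<close>, which has
  dimension \<open>n - 2\<close>; this is why \<open>n - 1\<close> from the divergence identity drops by one. The missing unit
  comes from the rotation of \<open>x\<close>: since \<open>\<langle>x, a\<rangle>\<close> vanishes to first order, moving \<open>x\<close> towards \<open>y\<close> turns
  \<open>a\<close> by an amount that contributes \<open>\<langle>y, a\<rangle> f\<close>.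
\<close>

lemma integral_tangent_mult:
  assumes a: "tangent_field n a ax" and f: "has_grad n f fx fy"
    and euler: "\<And>z. (\<Sum>i<n. yc i z * fy i z) = d * f z"
  shows "(real n - 2 + d) * (\<integral>z. (\<Sum>j<n. yc j z * a j z) * f z \<partial>M) = (\<integral>z. (\<Sum>j<n. a j z * fy j z) \<partial>M)"
proof -
  let ?q = "\<lambda>z. (\<Sum>j<n. yc j z * a j z) * f z" and ?r = "\<lambda>z. (\<Sum>j<n. a j z * fy j z)"
  have ag: "has_grad n (a j) (ax j) (\<lambda>k z. 0)" if "j < n" for j
    using a that by (simp add: tangent_field_def)
  note bm = bounded_meas_intros has_grad_bounded_meas(1)[OF f] has_grad_bounded_meas(1)[OF ag]
      has_grad_bounded_meas(3)[OF f]
  have q: "integrable M ?q"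
    by (intro integrable_bounded_meas bm) auto
  have r: "integrable M ?r"
    by (intro integrable_bounded_meas bm) auto
  \<comment> \<open>The divergence identity at \<open>u = y\<close>; the zeros are \<open>\<alpha>\<close> and the derivatives in \<open>y\<close> of \<open>a j\<close>.\<close>
  have "real (n - 1) * (\<integral>z. (\<Sum>j<n. (0 * xc j z + 1 * yc j z) * (a j z * f z)) \<partial>M) =
    (\<integral>z. (\<Sum>j<n. 0 * (ax j j z * f z + a j z * fx j z) + 1 * (0 * f z + a j z * fy j z))
       - (\<Sum>j<n. xc j z * (\<Sum>i<n. (0 * xc i z + 1 * yc i z) * (ax j i z * f z + a j z * fx i z)))
       - (\<Sum>j<n. yc j z * (\<Sum>i<n. (0 * xc i z + 1 * yc i z) * (0 * f z + a j z * fy i z))) \<partial>M)"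
    by (rule divergence_identity[OF has_grad_mult[OF ag f]])
  also have "(\<lambda>z. \<Sum>j<n. (0 * xc j z + 1 * yc j z) * (a j z * f z)) = ?q"
    by (simp add: sum_distrib_right mult.assoc)
  also have "(\<integral>z. (\<Sum>j<n. 0 * (ax j j z * f z + a j z * fx j z) + 1 * (0 * f z + a j z * fy j z))
       - (\<Sum>j<n. xc j z * (\<Sum>i<n. (0 * xc i z + 1 * yc i z) * (ax j i z * f z + a j z * fx i z)))
       - (\<Sum>j<n. yc j z * (\<Sum>i<n. (0 * xc i z + 1 * yc i z) * (0 * f z + a j z * fy i z))) \<partial>M) =
      (\<integral>z. ?r z - (d - 1) * ?q z \<partial>M)"
  proof (rule Bochner_Integration.integral_cong[OF refl])
    fix z assume "z \<in> space M"
    then have t: "(\<Sum>j<n. xc j z * a j z) = 0" "\<And>i. i < n \<Longrightarrow> (\<Sum>j<n. xc j z * ax j i z) = - a i z"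
      using a by (auto simp: space_M tangent_field_def)
    have "(\<Sum>j<n. xc j z * (\<Sum>i<n. yc i z * (ax j i z * f z + a j z * fx i z))) =
        (\<Sum>j<n. \<Sum>i<n. yc i z * f z * (xc j z * ax j i z)) + (\<Sum>j<n. xc j z * a j z) * (\<Sum>i<n. yc i z * fx i z)"
      unfolding sum_product by (simp add: sum_distrib_left sum.distrib[symmetric] algebra_simps)
    also have "(\<Sum>j<n. \<Sum>i<n. yc i z * f z * (xc j z * ax j i z)) = (\<Sum>i<n. yc i z * f z * (\<Sum>j<n. xc j z * ax j i z))"
      by (subst sum.swap) (simp add: sum_distrib_left)
    also have "\<dots> = - ?q z"
      by (simp add: t(2) sum_distrib_left sum_distrib_right sum_negf mult_ac)
    finally have x: "(\<Sum>j<n. xc j z * (\<Sum>i<n. yc i z * (ax j i z * f z + a j z * fx i z))) = - ?q z"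
      by (simp add: t(1))
    have "(\<Sum>j<n. yc j z * (\<Sum>i<n. yc i z * (a j z * fy i z))) = (\<Sum>j<n. yc j z * a j z) * (\<Sum>i<n. yc i z * fy i z)"
      unfolding sum_product by (simp add: sum_distrib_left mult_ac)
    then have y: "(\<Sum>j<n. yc j z * (\<Sum>i<n. yc i z * (a j z * fy i z))) = d * ?q z"
      by (simp add: euler)
    show "(\<Sum>j<n. 0 * (ax j j z * f z + a j z * fx j z) + 1 * (0 * f z + a j z * fy j z))
       - (\<Sum>j<n. xc j z * (\<Sum>i<n. (0 * xc i z + 1 * yc i z) * (ax j i z * f z + a j z * fx i z)))
       - (\<Sum>j<n. yc j z * (\<Sum>i<n. (0 * xc i z + 1 * yc i z) * (0 * f z + a j z * fy i z))) =
       ?r z - (d - 1) * ?q z"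
      using x y by (simp add: algebra_simps)
  qed
  finally have "real (n - 1) * (\<integral>z. ?q z \<partial>M) = (\<integral>z. ?r z \<partial>M) - (d - 1) * (\<integral>z. ?q z \<partial>M)"
    using q r by simp
  moreover have "real (n - 1) = real n - 1" using dim by (simp add: of_nat_diff)
  ultimately show ?thesis by (simp add: algebra_simps)
qed

end

section \<open>Trace inequalities and moments of quadratic forms\<close>

lemma symmetric_on_mmul_self: "symmetric_on n S \<Longrightarrow> symmetric_on n (mat_prod n S S)"
  unfolding symmetric_on_def mat_prod_def by (auto intro!: sum.cong simp: mult.commute)

lemma trace_mmul_self:
  assumes "symmetric_on n S"
  shows "mat_trace n (mat_prod n S S) = frobenius n S S"
proof -
  have "mat_trace n (mat_prod n S S) = (\<Sum>i<n. \<Sum>k<n. S i k * S k i)"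
    by (simp add: mat_trace_def mat_prod_def)
  also have "\<dots> = frobenius n S S"
    unfolding frobenius_def using assms by (intro sum.cong refl) (auto simp: symmetric_on_def)
  finally show ?thesis .
qed

lemma quad_cong: "(\<And>i j. i < n \<Longrightarrow> j < n \<Longrightarrow> A i j = B i j) \<Longrightarrow> quad_form n A z = quad_form n B z"
  by (simp add: quad_form_def mat_vec_def)

lemma inner_mat_vec_self:
  assumes "symmetric_on n S"
  shows "(\<Sum>j<n. mat_vec n S j z * mat_vec n S j z) = quad_form n (mat_prod n S S) z"
  unfolding inner_mat_vec using assms
  by (intro quad_cong) (auto simp: mat_prod_def symmetric_on_def intro!: sum.cong)

text \<open>
  Each entry of \<open>S\<^sup>2\<close> is the inner product of two rows of \<open>S\<close>, so the Cauchy-Schwarz inequality bounds its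
  square by the product of the squared lengths of these rows.
\<close>

lemma frobenius_square_le:
  assumes "symmetric_on n S"
  shows "frobenius n (mat_prod n S S) (mat_prod n S S) \<le> (frobenius n S S)\<^sup>2"
proof -
  have "(mat_prod n S S i j)\<^sup>2 \<le> (\<Sum>k<n. (S i k)\<^sup>2) * (\<Sum>k<n. (S j k)\<^sup>2)" if "i < n" "j < n" for i j
  proof -
    have "mat_prod n S S i j = (\<Sum>k<n. S i k * S j k)"
      unfolding mat_prod_def using assms that by (intro sum.cong) (auto simp: symmetric_on_def)
    then show ?thesis using Cauchy_Schwarz_ineq_sum[of "S i" "S j" "{..<n}"] by simp
  qed
  then have "frobenius n (mat_prod n S S) (mat_prod n S S) \<le>
      (\<Sum>i<n. \<Sum>j<n. (\<Sum>k<n. (S i k)\<^sup>2) * (\<Sum>k<n. (S j k)\<^sup>2))"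
    unfolding frobenius_def power2_eq_square[symmetric] by (intro sum_mono) auto
  also have "\<dots> = (frobenius n S S)\<^sup>2"
    by (simp add: frobenius_def power2_eq_square sum_product)
  finally show ?thesis .
qed

definition row_gram :: "nat \<Rightarrow> (nat \<Rightarrow> nat \<Rightarrow> real) \<Rightarrow> nat \<Rightarrow> nat \<Rightarrow> real" where
  "row_gram n K i j = (\<Sum>l<n. K i l * K j l)"

lemma symmetric_on_row_gram: "symmetric_on n (row_gram n K)"
  by (simp add: symmetric_on_def row_gram_def mult.commute)

lemma trace_row_gram: "mat_trace n (row_gram n K) = frobenius n K K"
  by (simp add: mat_trace_def row_gram_def frobenius_def)

text \<open>
  The gain of a factor 2 over the symmetric case reflects that singular values of a skew-symmetric matrix
  are paired. A proof without a normal form: the sum of the squares of all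
  \<open>K\<^sub>i\<^sub>j K\<^sub>k\<^sub>l - K\<^sub>i\<^sub>k K\<^sub>j\<^sub>l + K\<^sub>i\<^sub>l K\<^sub>j\<^sub>k\<close>, the Pfaffians of the \<open>4 \<times> 4\<close> principal submatrices, expands to
  \<open>3 \<parallel>K\<parallel>\<^sup>4 - 6 \<parallel>K K\<^sup>T\<parallel>\<^sup>2\<close>.
\<close>

lemma frobenius_row_gram_skew_le:
  assumes "skew_on n K"
  shows "2 * frobenius n (row_gram n K) (row_gram n K) \<le> (frobenius n K K)\<^sup>2"
proof -
  let ?P = "row_gram n K" and ?N = "frobenius n K K"
  let ?t = "frobenius n ?P ?P"
  have sk: "K i j = - K j i" if "i < n" "j < n" for i j
    using assms that unfolding skew_on_def by blast
  have N: "?N = (\<Sum>i<n. \<Sum>j<n. K i j * K i j)" by (simp add: frobenius_def)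
  have col: "(\<Sum>k<n. K k i * K k j) = ?P i j" if "i < n" "j < n" for i j
    unfolding row_gram_def using that by (intro sum.cong) (auto simp: sk[of _ i] sk[of _ j])
  have sq1: "(\<Sum>i<n. \<Sum>j<n. \<Sum>k<n. \<Sum>l<n. (K i j * K k l)\<^sup>2) = ?N\<^sup>2"
  proof -
    have "?N\<^sup>2 = (\<Sum>i<n. \<Sum>j<n. (K i j * K i j) * ?N)"
      unfolding power2_eq_square by (subst (1) N) (simp add: sum_distrib_right)
    then show ?thesis
      by (simp add: N sum_distrib_left power2_eq_square mult_ac)
  qed
  have sq2: "(\<Sum>i<n. \<Sum>j<n. \<Sum>k<n. \<Sum>l<n. (K i k * K j l)\<^sup>2) = ?N\<^sup>2"
    unfolding sq1[symmetric] by (intro sum.cong refl sum.swap)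
  have sq3: "(\<Sum>i<n. \<Sum>j<n. \<Sum>k<n. \<Sum>l<n. (K i l * K j k)\<^sup>2) = ?N\<^sup>2"
    unfolding sq2[symmetric] by (intro sum.cong refl sum.swap)
  have c12: "(\<Sum>i<n. \<Sum>j<n. \<Sum>k<n. \<Sum>l<n. (K i j * K k l) * (K i k * K j l)) = ?t"
  proof -
    have "(\<Sum>i<n. \<Sum>j<n. \<Sum>k<n. \<Sum>l<n. (K i j * K k l) * (K i k * K j l)) =
        (\<Sum>i<n. \<Sum>j<n. \<Sum>k<n. (K i j * K i k) * ?P j k)"
      by (simp add: row_gram_def sum_distrib_left mult_ac)
    also have "\<dots> = (\<Sum>j<n. \<Sum>i<n. \<Sum>k<n. (K i j * K i k) * ?P j k)"
      by (rule sum.swap)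
    also have "\<dots> = (\<Sum>j<n. \<Sum>k<n. \<Sum>i<n. (K i j * K i k) * ?P j k)"
      by (intro sum.cong refl sum.swap)
    also have "\<dots> = ?t"
      unfolding frobenius_def by (intro sum.cong refl) (simp add: sum_distrib_right[symmetric] col)
    finally show ?thesis .
  qed
  have c23: "(\<Sum>i<n. \<Sum>j<n. \<Sum>k<n. \<Sum>l<n. (K i k * K j l) * (K i l * K j k)) = ?t"
  proof -
    have "(\<Sum>i<n. \<Sum>j<n. \<Sum>k<n. \<Sum>l<n. (K i k * K j l) * (K i l * K j k)) =
        (\<Sum>i<n. \<Sum>j<n. (\<Sum>k<n. K i k * K j k) * (\<Sum>l<n. K i l * K j l))"
      by (simp add: sum_product mult_ac)
    then show ?thesis by (simp add: frobenius_def row_gram_def)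
  qed
  have c13: "(\<Sum>i<n. \<Sum>j<n. \<Sum>k<n. \<Sum>l<n. (K i j * K k l) * (K i l * K j k)) = - ?t"
  proof -
    have "(\<Sum>i<n. \<Sum>j<n. \<Sum>k<n. \<Sum>l<n. (K i j * K k l) * (K i l * K j k)) =
        (\<Sum>i<n. \<Sum>j<n. \<Sum>l<n. \<Sum>k<n. (K i j * K k l) * (K i l * K j k))"
      by (intro sum.cong refl sum.swap)
    also have "\<dots> = - (\<Sum>i<n. \<Sum>j<n. \<Sum>l<n. \<Sum>k<n. (K i j * K l k) * (K i l * K j k))"
      unfolding sum_negf[symmetric]
    proof (intro sum.cong refl)
      fix l k assume "l \<in> {..<n}" "k \<in> {..<n}"
      then show "K i j * K k l * (K i l * K j k) = - (K i j * K l k * (K i l * K j k))" for i j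
        by (simp add: sk[of k l])
    qed
    finally show ?thesis unfolding c12 .
  qed
  have "0 \<le> (\<Sum>i<n. \<Sum>j<n. \<Sum>k<n. \<Sum>l<n. (K i j * K k l - K i k * K j l + K i l * K j k)\<^sup>2)"
    by (intro sum_nonneg) auto
  also have "\<dots> = (\<Sum>i<n. \<Sum>j<n. \<Sum>k<n. \<Sum>l<n. (K i j * K k l)\<^sup>2 + (K i k * K j l)\<^sup>2 + (K i l * K j k)\<^sup>2
      - 2 * ((K i j * K k l) * (K i k * K j l)) - 2 * ((K i k * K j l) * (K i l * K j k))
      + 2 * ((K i j * K k l) * (K i l * K j k)))"
    by (intro sum.cong refl) (simp add: power2_eq_square algebra_simps)
  also have "\<dots> = ?N\<^sup>2 + ?N\<^sup>2 + ?N\<^sup>2 - 2 * ?t - 2 * ?t + 2 * (- ?t)"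
    unfolding sum.distrib sum_subtractf sum_distrib_left[symmetric] sq1 sq2 sq3 c12 c13 c23 ..
  finally show ?thesis by simp
qed

lemma tangent_field_skew:
  assumes "skew_on n K"
  shows "tangent_field n (mat_vec n (\<lambda>i j. K j i)) (\<lambda>j k z. K k j)"
  unfolding tangent_field_def
proof (intro conjI allI impI ballI)
  have sk: "K i j = - K j i" if "i < n" "j < n" for i j
    using assms that unfolding skew_on_def by blast
  show "has_grad n (mat_vec n (\<lambda>i j. K j i) j) (\<lambda>k z. K k j) (\<lambda>k z. 0)" for j
    by (rule has_grad_mat_vec)
  show "(\<Sum>j<n. xc j z * mat_vec n (\<lambda>i j. K j i) j z) = 0" for z
  proof -
    let ?s = "\<Sum>j<n. \<Sum>i<n. xc j z * (K i j * xc i z)"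
    have "?s = (\<Sum>i<n. \<Sum>j<n. xc j z * (K i j * xc i z))" by (rule sum.swap)
    also have "\<dots> = (\<Sum>i<n. \<Sum>j<n. - (xc i z * (K j i * xc j z)))"
    proof (intro sum.cong refl)
      fix i j assume "i \<in> {..<n}" "j \<in> {..<n}"
      then show "xc j z * (K i j * xc i z) = - (xc i z * (K j i * xc j z))" by (simp add: sk[of i j])
    qed
    also have "\<dots> = - ?s" by (simp add: sum_negf)
    finally show ?thesis by (simp add: mat_vec_def sum_distrib_left)
  qed
  show "(\<Sum>j<n. xc j z * K i j) = - mat_vec n (\<lambda>i j. K j i) i z" if "i < n" for i z
    unfolding mat_vec_def sum_negf[symmetric]
  proof (intro sum.cong refl)
    fix j assume "j \<in> {..<n}"
    then show "xc j z * K i j = - (K j i * xc j z)" using that by (simp add: sk[of i j])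
  qed
qed

text \<open>
  The component of \<open>S x\<close> orthogonal to \<open>x\<close>, multiplied by \<open>|x|\<^sup>2\<close>: this makes the orthogonality a polynomial
  identity in \<open>x\<close>, which can be differentiated, and changes nothing on \<open>T\<close>.
\<close>

definition sphere_field :: "nat \<Rightarrow> (nat \<Rightarrow> nat \<Rightarrow> real) \<Rightarrow> nat \<Rightarrow> real vec \<times> real vec \<Rightarrow> real" where
  "sphere_field n S j z = (\<Sum>i<n. xc i z * xc i z) * mat_vec n S j z - quad_form n S z * xc j z"

lemma tangent_field_sphere_field:
  assumes "symmetric_on n S"
  shows "tangent_field n (sphere_field n S)
    (\<lambda>j k z. 2 * xc k z * mat_vec n S j z + (\<Sum>i<n. xc i z * xc i z) * S j k
       - (2 * mat_vec n S k z * xc j z + quad_form n S z * (if k = j then 1 else 0)))"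
  unfolding tangent_field_def
proof (intro conjI allI impI ballI)
  have norm: "has_grad n (\<lambda>z. \<Sum>i<n. xc i z * xc i z) (\<lambda>k z. 2 * xc k z) (\<lambda>k z. 0)"
    by (rule has_grad_cong[OF has_grad_sum[where S = "{..<n}", OF has_grad_mult[OF has_grad_xc has_grad_xc]]])
      (auto simp: sum.distrib if_distrib[of "\<lambda>u. u * _"] if_distrib[of "\<lambda>u. _ * u"] cong: if_cong)
  show "has_grad n (sphere_field n S j) (\<lambda>k z. 2 * xc k z * mat_vec n S j z + (\<Sum>i<n. xc i z * xc i z) * S j k
       - (2 * mat_vec n S k z * xc j z + quad_form n S z * (if k = j then 1 else 0))) (\<lambda>k z. 0)" if "j < n" for j
    unfolding sphere_field_def
    by (rule has_grad_cong[OF has_grad_add[OF has_grad_mult[OF norm has_grad_mat_vec]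
         has_grad_mult[OF has_grad_const[of n "-1"] has_grad_mult[OF has_grad_quad[OF assms] has_grad_xc[OF that]]]]])
      auto
  fix z assume z: "z \<in> T_space n"
  then have one: "(\<Sum>i<n. xc i z * xc i z) = 1" by (simp add: T_space_coords)
  show "(\<Sum>j<n. xc j z * sphere_field n S j z) = 0"
  proof -
    have "(\<Sum>j<n. xc j z * sphere_field n S j z) = (\<Sum>j<n. xc j z * (mat_vec n S j z - quad_form n S z * xc j z))"
      by (simp add: sphere_field_def one)
    also have "\<dots> = (\<Sum>j<n. xc j z * mat_vec n S j z) - quad_form n S z * (\<Sum>j<n. xc j z * xc j z)"
      by (simp add: sum_subtractf right_diff_distrib sum_distrib_left mult_ac)
    finally show ?thesis unfolding one by (simp add: quad_form_def)
  qed
  fix i assume i: "i < n"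
  have "(\<Sum>j<n. xc j z * (2 * xc i z * mat_vec n S j z + 1 * S j i
       - (2 * mat_vec n S i z * xc j z + quad_form n S z * (if i = j then 1 else 0)))) =
     2 * xc i z * (\<Sum>j<n. xc j z * mat_vec n S j z) + (\<Sum>j<n. S j i * xc j z)
       - (2 * mat_vec n S i z * (\<Sum>j<n. xc j z * xc j z) + (\<Sum>j<n. if i = j then quad_form n S z * xc j z else 0))"
    by (simp add: sum_subtractf sum.distrib right_diff_distrib distrib_left sum_distrib_left mult_ac
      if_distrib[of "\<lambda>u. _ * u"] cong: if_cong)
  also have "(\<Sum>j<n. S j i * xc j z) = mat_vec n S i z"
    unfolding mat_vec_def using assms i by (intro sum.cong) (auto simp: symmetric_on_def)
  finally show "(\<Sum>j<n. xc j z * (2 * xc i z * mat_vec n S j z + (\<Sum>i<n. xc i z * xc i z) * S j i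
       - (2 * mat_vec n S i z * xc j z + quad_form n S z * (if i = j then 1 else 0)))) = - sphere_field n S i z"
    unfolding one sphere_field_def using i by (simp add: one quad_form_def)
qed

context frame_measure
begin

lemma integral_quad: "real n * (\<integral>z. quad_form n A z \<partial>M) = mat_trace n A"
proof -
  interpret prob_space M by (rule prob_M)
  show ?thesis
    using integral_quad_mult[OF has_grad_const[of n 1], of 0 A] by (simp add: prob_space)
qed

lemma integral_inner_mat_vec: "real n * (\<integral>z. (\<Sum>j<n. mat_vec n A j z * mat_vec n B j z) \<partial>M) = frobenius n A B"
  by (simp add: inner_mat_vec integral_quad trace_mmul_transpose)

lemma bounded_meas_mat_vec: "bounded_meas n (mat_vec n A i)"
  by (rule has_grad_bounded_meas(1)[OF has_grad_mat_vec])

lemma bounded_meas_quad: "bounded_meas n (quad_form n A)"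
  unfolding quad_form_def by (intro bounded_meas_intros bounded_meas_mat_vec) auto

lemma euler_quad: "(\<Sum>i<n. xc i z * (2 * mat_vec n B i z)) = 2 * quad_form n B z"
  by (simp add: quad_form_def sum_distrib_left mult_ac)

text \<open>
  Removing the form of \<open>A\<close> by parts leaves quadratic forms, because \<open>\<langle>A x, B x\<rangle>\<close> is the form of
  \<open>A\<^sup>T B\<close>. The moments with more factors follow the same scheme, always removing a
  factor \<open>\<langle>x, S x\<rangle>\<close>, whose trace term vanishes.
\<close>

lemma integral_quad_quad:
  assumes "symmetric_on n B"
  shows "real n * (real n + 2) * (\<integral>z. quad_form n A z * quad_form n B z \<partial>M) = mat_trace n A * mat_trace n B + 2 * frobenius n A B"
proof -
  have "(real n + 2) * (\<integral>z. quad_form n A z * quad_form n B z \<partial>M) =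
      (\<integral>z. mat_trace n A * quad_form n B z + (\<Sum>j<n. mat_vec n A j z * (2 * mat_vec n B j z)) \<partial>M)"
    by (rule integral_quad_mult[OF has_grad_quad[OF assms] euler_quad])
  also have "\<dots> = (\<integral>z. mat_trace n A * quad_form n B z + 2 * (\<Sum>j<n. mat_vec n A j z * mat_vec n B j z) \<partial>M)"
    by (simp add: sum_distrib_left mult_ac)
  also have "\<dots> = mat_trace n A * (\<integral>z. quad_form n B z \<partial>M) + 2 * (\<integral>z. (\<Sum>j<n. mat_vec n A j z * mat_vec n B j z) \<partial>M)"
    by (subst Bochner_Integration.integral_add)
      (auto intro!: integrable_bounded_meas bounded_meas_intros bounded_meas_mat_vec bounded_meas_quad)
  finally have "real n * ((real n + 2) * (\<integral>z. quad_form n A z * quad_form n B z \<partial>M)) =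
     mat_trace n A * (real n * (\<integral>z. quad_form n B z \<partial>M)) + 2 * (real n * (\<integral>z. (\<Sum>j<n. mat_vec n A j z * mat_vec n B j z) \<partial>M))"
    by (simp add: algebra_simps)
  then show ?thesis by (simp add: integral_quad integral_inner_mat_vec mult.assoc)
qed

lemma integral_quad_square:
  assumes "symmetric_on n S" "mat_trace n S = 0"
  shows "real n * (real n + 2) * (\<integral>z. (quad_form n S z)\<^sup>2 \<partial>M) = 2 * frobenius n S S"
  using integral_quad_quad[OF assms(1), of S] assms(2) by (simp add: power2_eq_square)

lemma integral_quad_mmul_square:
  assumes "symmetric_on n S"
  defines "S2 \<equiv> mat_prod n S S"
  shows "real n * (real n + 2) * (\<integral>z. (quad_form n S2 z)\<^sup>2 \<partial>M) = (frobenius n S S)\<^sup>2 + 2 * frobenius n S2 S2"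
  using integral_quad_quad[OF symmetric_on_mmul_self[OF assms(1)], of S2]
  by (simp add: power2_eq_square S2_def trace_mmul_self[OF assms(1)])

lemma integral_quad_square_mmul:
  assumes "symmetric_on n S" "mat_trace n S = 0"
  defines "S2 \<equiv> mat_prod n S S"
  shows "real n * (real n + 2) * (real n + 4) * (\<integral>z. (quad_form n S z)\<^sup>2 * quad_form n S2 z \<partial>M) =
    2 * (frobenius n S S)\<^sup>2 + 8 * frobenius n S2 S2"
proof -
  let ?q = "quad_form n S" and ?q2 = "quad_form n S2" and ?q3 = "quad_form n (mat_prod n (\<lambda>i j. S j i) S2)"
  have s2: "symmetric_on n S2" unfolding S2_def by (rule symmetric_on_mmul_self[OF assms(1)])
  have "(real n + 4) * (\<integral>z. ?q z * (?q z * ?q2 z) \<partial>M) =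
    (\<integral>z. mat_trace n S * (?q z * ?q2 z) +
       (\<Sum>j<n. mat_vec n S j z * (2 * mat_vec n S j z * ?q2 z + ?q z * (2 * mat_vec n S2 j z))) \<partial>M)"
  proof (rule integral_quad_mult)
    show "has_grad n (\<lambda>z. ?q z * ?q2 z) (\<lambda>k z. 2 * mat_vec n S k z * ?q2 z + ?q z * (2 * mat_vec n S2 k z)) (\<lambda>k z. 0)"
      by (rule has_grad_cong[OF has_grad_mult[OF has_grad_quad[OF assms(1)] has_grad_quad[OF s2]]]) auto
    show "(\<Sum>i<n. xc i z * (2 * mat_vec n S i z * ?q2 z + ?q z * (2 * mat_vec n S2 i z))) = 4 * (?q z * ?q2 z)" for z
    proof -
      have "(\<Sum>i<n. xc i z * (2 * mat_vec n S i z * ?q2 z + ?q z * (2 * mat_vec n S2 i z))) =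
        (\<Sum>i<n. xc i z * (2 * mat_vec n S i z)) * ?q2 z + ?q z * (\<Sum>i<n. xc i z * (2 * mat_vec n S2 i z))"
        by (simp add: distrib_left sum.distrib sum_distrib_left sum_distrib_right mult_ac)
      then show ?thesis by (simp add: euler_quad)
    qed
  qed
  also have "\<dots> = (\<integral>z. 2 * (?q2 z)\<^sup>2 + 2 * (?q3 z * ?q z) \<partial>M)"
  proof (rule Bochner_Integration.integral_cong[OF refl])
    fix z
    have "(\<Sum>j<n. mat_vec n S j z * (2 * mat_vec n S j z * ?q2 z + ?q z * (2 * mat_vec n S2 j z))) =
      2 * ?q2 z * (\<Sum>j<n. mat_vec n S j z * mat_vec n S j z) + 2 * ?q z * (\<Sum>j<n. mat_vec n S j z * mat_vec n S2 j z)"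
      by (simp add: distrib_left sum.distrib sum_distrib_left mult_ac)
    then show "mat_trace n S * (?q z * ?q2 z) +
       (\<Sum>j<n. mat_vec n S j z * (2 * mat_vec n S j z * ?q2 z + ?q z * (2 * mat_vec n S2 j z))) = 2 * (?q2 z)\<^sup>2 + 2 * (?q3 z * ?q z)"
      unfolding inner_mat_vec_self[OF assms(1)] unfolding inner_mat_vec
      by (simp add: assms(2) S2_def power2_eq_square)
  qed
  also have "\<dots> = 2 * (\<integral>z. (?q2 z)\<^sup>2 \<partial>M) + 2 * (\<integral>z. ?q3 z * ?q z \<partial>M)"
    by (subst Bochner_Integration.integral_add)
      (auto intro!: integrable_bounded_meas bounded_meas_intros bounded_meas_quad)
  finally have "real n * (real n + 2) * ((real n + 4) * (\<integral>z. ?q z * (?q z * ?q2 z) \<partial>M)) =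
    2 * (real n * (real n + 2) * (\<integral>z. (?q2 z)\<^sup>2 \<partial>M)) + 2 * (real n * (real n + 2) * (\<integral>z. ?q3 z * ?q z \<partial>M))"
    by (simp add: algebra_simps)
  also have "\<dots> = 2 * ((frobenius n S S)\<^sup>2 + 2 * frobenius n S2 S2) + 2 * (2 * frobenius n (mat_prod n (\<lambda>i j. S j i) S2) S)"
    using integral_quad_mmul_square[OF assms(1)]
    by (simp add: integral_quad_quad[OF assms(1)] assms(2) S2_def)
  also have "frobenius n (mat_prod n (\<lambda>i j. S j i) S2) S = frobenius n S2 S2"
  proof -
    have "frobenius n (mat_prod n (\<lambda>i j. S j i) S2) S = (\<Sum>i<n. \<Sum>j<n. \<Sum>k<n. S k i * S2 k j * S i j)"
      by (simp add: frobenius_def mat_prod_def sum_distrib_right)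
    also have "\<dots> = (\<Sum>i<n. \<Sum>k<n. \<Sum>j<n. S k i * S2 k j * S i j)"
      by (intro sum.cong refl sum.swap)
    also have "\<dots> = (\<Sum>k<n. \<Sum>i<n. \<Sum>j<n. S k i * S2 k j * S i j)"
      by (rule sum.swap)
    also have "\<dots> = (\<Sum>k<n. \<Sum>j<n. \<Sum>i<n. S k i * S2 k j * S i j)"
      by (intro sum.cong refl sum.swap)
    also have "\<dots> = frobenius n S2 S2"
      unfolding frobenius_def by (simp add: S2_def mat_prod_def[of n S S] sum_distrib_left mult_ac)
    finally show ?thesis .
  qed
  finally show ?thesis by (simp add: power2_eq_square mult_ac)
qed

lemma integral_quad_fourth:
  assumes "symmetric_on n S" "mat_trace n S = 0"
  defines "S2 \<equiv> mat_prod n S S"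
  shows "real n * (real n + 2) * (real n + 4) * (real n + 6) * (\<integral>z. (quad_form n S z) ^ 4 \<partial>M) =
    12 * (frobenius n S S)\<^sup>2 + 48 * frobenius n S2 S2"
proof -
  let ?q = "quad_form n S" and ?q2 = "quad_form n S2"
  have "(real n + 6) * (\<integral>z. ?q z * (?q z * (?q z * ?q z)) \<partial>M) =
    (\<integral>z. mat_trace n S * (?q z * (?q z * ?q z)) + (\<Sum>j<n. mat_vec n S j z * (6 * (?q z)\<^sup>2 * mat_vec n S j z)) \<partial>M)"
  proof (rule integral_quad_mult)
    note g = has_grad_quad[OF assms(1)]
    show "has_grad n (\<lambda>z. ?q z * (?q z * ?q z)) (\<lambda>k z. 6 * (?q z)\<^sup>2 * mat_vec n S k z) (\<lambda>k z. 0)"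
      by (rule has_grad_cong[OF has_grad_mult[OF g has_grad_mult[OF g g]]]) (auto simp: power2_eq_square)
    show "(\<Sum>i<n. xc i z * (6 * (?q z)\<^sup>2 * mat_vec n S i z)) = 6 * (?q z * (?q z * ?q z))" for z
    proof -
      have "(\<Sum>i<n. xc i z * (6 * (?q z)\<^sup>2 * mat_vec n S i z)) = 3 * (?q z)\<^sup>2 * (\<Sum>i<n. xc i z * (2 * mat_vec n S i z))"
        by (simp add: sum_distrib_left mult_ac)
      then show ?thesis by (simp add: euler_quad power2_eq_square)
    qed
  qed
  also have "\<dots> = (\<integral>z. 6 * ((?q z)\<^sup>2 * ?q2 z) \<partial>M)"
  proof (rule Bochner_Integration.integral_cong[OF refl])
    fix z
    have "(\<Sum>j<n. mat_vec n S j z * (6 * (?q z)\<^sup>2 * mat_vec n S j z)) = 6 * (?q z)\<^sup>2 * (\<Sum>j<n. mat_vec n S j z * mat_vec n S j z)"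
      by (simp add: sum_distrib_left mult_ac)
    then show "mat_trace n S * (?q z * (?q z * ?q z)) + (\<Sum>j<n. mat_vec n S j z * (6 * (?q z)\<^sup>2 * mat_vec n S j z)) =
        6 * ((?q z)\<^sup>2 * ?q2 z)"
      by (simp add: inner_mat_vec_self[OF assms(1)] assms(2) S2_def)
  qed
  finally have "(real n + 6) * (\<integral>z. ?q z ^ 4 \<partial>M) = 6 * (\<integral>z. (?q z)\<^sup>2 * ?q2 z \<partial>M)"
    by (simp add: power4_eq_xxxx mult_ac)
  then have "real n * (real n + 2) * (real n + 4) * ((real n + 6) * (\<integral>z. ?q z ^ 4 \<partial>M)) =
    6 * (real n * (real n + 2) * (real n + 4) * (\<integral>z. (?q z)\<^sup>2 * ?q2 z \<partial>M))"
    by simp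
  also have "\<dots> = 12 * (frobenius n S S)\<^sup>2 + 48 * frobenius n S2 S2"
    unfolding S2_def integral_quad_square_mmul[OF assms(1,2)] by simp
  finally show ?thesis by (simp add: mult.assoc)
qed

lemma has_grad_inner_y:
  assumes "\<And>j. j < n \<Longrightarrow> has_grad n (a j) (ax j) (\<lambda>k z. 0)"
  shows "has_grad n (\<lambda>z. \<Sum>j<n. yc j z * a j z) (\<lambda>k z. \<Sum>j<n. yc j z * ax j k z) (\<lambda>k z. a k z)"
  by (rule has_grad_cong[OF has_grad_sum[where S = "{..<n}", OF has_grad_mult[OF has_grad_yc assms]]])
    (auto simp: if_distrib[of "\<lambda>u. u * _"] cong: if_cong)

text \<open>
  Given \<open>x\<close>, the vector \<open>y\<close> has covariance \<open>1 / (n - 1)\<close> times the projection orthogonal to \<open>x\<close>, and it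
  is enough that one of the two fields is tangent for the projection to disappear.
\<close>

lemma integral_tangent_pair:
  assumes a: "tangent_field n a ax" and b: "\<And>j. j < n \<Longrightarrow> has_grad n (b j) (bx j) (\<lambda>k z. 0)"
    and c: "has_grad n c cx (\<lambda>k z. 0)"
  shows "(real n - 1) * (\<integral>z. (\<Sum>j<n. yc j z * a j z) * (c z * (\<Sum>j<n. yc j z * b j z)) \<partial>M) =
    (\<integral>z. c z * (\<Sum>j<n. a j z * b j z) \<partial>M)"
proof -
  have "(real n - 2 + 1) * (\<integral>z. (\<Sum>j<n. yc j z * a j z) * (c z * (\<Sum>j<n. yc j z * b j z)) \<partial>M) =
    (\<integral>z. (\<Sum>j<n. a j z * (0 * (\<Sum>j<n. yc j z * b j z) + c z * b j z)) \<partial>M)"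
    by (rule integral_tangent_mult[OF a has_grad_mult[OF c has_grad_inner_y[OF b]]])
      (auto simp: sum_distrib_left mult_ac)
  then show ?thesis by (simp add: sum_distrib_left mult_ac)
qed

text \<open>
  The constant 3 counts the pairings of the four factors \<open>\<langle>y, a\<rangle>\<close>, as for a Gaussian vector: the first
  integration by parts pairs one factor with any of the three others, and the second treats the
  remaining pair.
\<close>

lemma integral_tangent_fourth:
  assumes a: "tangent_field n a ax"
  shows "(real n - 1) * (real n + 1) * (\<integral>z. (\<Sum>j<n. yc j z * a j z) ^ 4 \<partial>M) =
    3 * (\<integral>z. (\<Sum>j<n. a j z * a j z)\<^sup>2 \<partial>M)"
proof -
  let ?s = "\<lambda>z. \<Sum>j<n. yc j z * a j z" and ?c = "\<lambda>z. \<Sum>j<n. a j z * a j z"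
  have g: "\<And>j. j < n \<Longrightarrow> has_grad n (a j) (ax j) (\<lambda>k z. 0)"
    using a by (simp add: tangent_field_def)
  note s = has_grad_inner_y[OF g]
  have c: "has_grad n ?c (\<lambda>k z. \<Sum>j<n. ax j k z * a j z + a j z * ax j k z) (\<lambda>k z. 0)"
    by (rule has_grad_cong[OF has_grad_sum[where S = "{..<n}", OF has_grad_mult[OF g g]]]) auto
  have "(real n - 2 + 3) * (\<integral>z. ?s z * (?s z * (?s z * ?s z)) \<partial>M) =
    (\<integral>z. (\<Sum>j<n. a j z * (a j z * (?s z * ?s z) + ?s z * (a j z * ?s z + ?s z * a j z))) \<partial>M)"
  proof (rule integral_tangent_mult[OF a has_grad_mult[OF s has_grad_mult[OF s s]]])
    show "(\<Sum>i<n. yc i z * (a i z * (?s z * ?s z) + ?s z * (a i z * ?s z + ?s z * a i z))) =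
      3 * (?s z * (?s z * ?s z))" for z
    proof -
      have "(\<Sum>i<n. yc i z * (a i z * (?s z * ?s z) + ?s z * (a i z * ?s z + ?s z * a i z))) =
        (\<Sum>i<n. (yc i z * a i z) * (3 * (?s z * ?s z)))"
        by (intro sum.cong refl) (simp add: algebra_simps)
      then show ?thesis unfolding sum_distrib_right[symmetric] by simp
    qed
  qed
  also have "\<dots> = (\<integral>z. 3 * (?s z * (?c z * ?s z)) \<partial>M)"
  proof (rule Bochner_Integration.integral_cong[OF refl])
    fix z
    have "(\<Sum>j<n. a j z * (a j z * (?s z * ?s z) + ?s z * (a j z * ?s z + ?s z * a j z))) =
        (\<Sum>j<n. (a j z * a j z) * (3 * (?s z * ?s z)))"
      by (intro sum.cong refl) (simp add: algebra_simps)
    then show "(\<Sum>j<n. a j z * (a j z * (?s z * ?s z) + ?s z * (a j z * ?s z + ?s z * a j z))) =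
       3 * (?s z * (?c z * ?s z))"
      unfolding sum_distrib_right[symmetric] by (simp add: mult_ac)
  qed
  finally have "(real n + 1) * (\<integral>z. ?s z ^ 4 \<partial>M) = 3 * (\<integral>z. ?s z * (?c z * ?s z) \<partial>M)"
    by (simp add: power4_eq_xxxx mult_ac add.commute)
  moreover have "(real n - 1) * (\<integral>z. ?s z * (?c z * ?s z) \<partial>M) = (\<integral>z. ?c z * ?c z \<partial>M)"
    by (rule integral_tangent_pair[OF a g c])
  moreover have "(real n - 1) * ((real n + 1) * (\<integral>z. ?s z ^ 4 \<partial>M)) =
      3 * ((real n - 1) * (\<integral>z. ?s z * (?c z * ?s z) \<partial>M))"
    using calculation by simp
  ultimately show ?thesis by (simp add: mult.assoc power2_eq_square)
qed

end

section \<open>Second and fourth moments of bilinear forms\<close>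

text \<open>
  Subtracting a multiple of the identity changes the bilinear form by a multiple of \<open>\<langle>x, y\<rangle>\<close>, which vanishes
  on \<open>T\<close>. Trace 0 removes most terms from the moments.
\<close>

definition traceless_part :: "nat \<Rightarrow> (nat \<Rightarrow> nat \<Rightarrow> real) \<Rightarrow> nat \<Rightarrow> nat \<Rightarrow> real" where
  "traceless_part n A i j = A i j - (if i = j then mat_trace n A / real n else 0)"

lemma trace_traceless_part: "0 < n \<Longrightarrow> mat_trace n (traceless_part n A) = 0"
  by (simp add: mat_trace_def traceless_part_def sum_subtractf)

lemma symmetric_on_traceless_part: "symmetric_on n A \<Longrightarrow> symmetric_on n (traceless_part n A)"
  by (auto simp: symmetric_on_def traceless_part_def)

lemma bilin_traceless_part:
  assumes "z \<in> T_space n"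
  shows "bilin n (traceless_part n A) z = bilin n A z"
proof -
  let ?c = "mat_trace n A / real n"
  have "bilin n (traceless_part n A) z = bilin n A z - (\<Sum>i<n. \<Sum>j<n. if j = i then ?c * (xc i z * yc i z) else 0)"
    unfolding bilin_def sum_subtractf[symmetric]
    by (intro sum.cong refl) (auto simp: traceless_part_def algebra_simps)
  also have "\<dots> = bilin n A z - ?c * (\<Sum>i<n. xc i z * yc i z)"
    by (simp add: sum_distrib_left)
  finally show ?thesis using assms by (simp add: T_space_coords)
qed

lemma bilin_symmetric_skew_split:
  "bilin n A z = bilin n (\<lambda>i j. (A i j + A j i) / 2) z + bilin n (\<lambda>i j. (A i j - A j i) / 2) z"
  unfolding bilin_def sum.distrib[symmetric] by (intro sum.cong refl) (simp add: field_simps)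

lemma bilin_symmetric_eq_inner:
  "symmetric_on n S \<Longrightarrow> bilin n S z = (\<Sum>j<n. yc j z * mat_vec n S j z)"
  unfolding bilin_eq_inner mat_vec_def by (intro sum.cong refl arg_cong2[where f = "(*)"]) (auto simp: symmetric_on_def)

lemma sphere_field_on_T:
  assumes "z \<in> T_space n"
  shows "sphere_field n S j z = mat_vec n S j z - quad_form n S z * xc j z"
  using assms by (simp add: sphere_field_def T_space_coords)

lemma inner_sphere_field:
  assumes "symmetric_on n S" "z \<in> T_space n"
  shows "(\<Sum>j<n. yc j z * sphere_field n S j z) = bilin n S z"
proof -
  have "(\<Sum>j<n. yc j z * sphere_field n S j z) =
      (\<Sum>j<n. yc j z * mat_vec n S j z) - quad_form n S z * (\<Sum>j<n. xc j z * yc j z)"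
    by (simp add: sphere_field_on_T[OF assms(2)] sum_subtractf right_diff_distrib sum_distrib_left mult_ac)
  then show ?thesis using assms by (simp add: bilin_symmetric_eq_inner T_space_coords)
qed

lemma norm_sphere_field:
  assumes "symmetric_on n S" "z \<in> T_space n"
  shows "(\<Sum>j<n. sphere_field n S j z * sphere_field n S j z) = quad_form n (mat_prod n S S) z - (quad_form n S z)\<^sup>2"
proof -
  let ?q = "quad_form n S z"
  have "(\<Sum>j<n. sphere_field n S j z * sphere_field n S j z) =
      (\<Sum>j<n. mat_vec n S j z * mat_vec n S j z - 2 * ?q * (xc j z * mat_vec n S j z) + ?q\<^sup>2 * (xc j z * xc j z))"
    unfolding sphere_field_on_T[OF assms(2)]
    by (intro sum.cong refl) (simp add: power2_eq_square algebra_simps)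
  also have "\<dots> = (\<Sum>j<n. mat_vec n S j z * mat_vec n S j z) - 2 * ?q * (\<Sum>j<n. xc j z * mat_vec n S j z)
      + ?q\<^sup>2 * (\<Sum>j<n. xc j z * xc j z)"
    by (simp add: sum.distrib sum_subtractf sum_distrib_left)
  also have "\<dots> = quad_form n (mat_prod n S S) z - 2 * ?q * ?q + ?q\<^sup>2 * 1"
    using assms(2) by (simp add: inner_mat_vec_self[OF assms(1)] quad_form_def[symmetric] T_space_coords)
  finally show ?thesis by (simp add: power2_eq_square)
qed

context frame_measure
begin

lemma bounded_meas_bilin: "bounded_meas n (bilin n A)"
  unfolding bilin_def by (intro bounded_meas_intros) auto

lemma skew_second_moment:
  assumes "skew_on n K"
  shows "real n * (real n - 1) * (\<integral>z. (bilin n K z)\<^sup>2 \<partial>M) = frobenius n K K"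
proof -
  let ?a = "mat_vec n (\<lambda>i j. K j i)"
  have "(real n - 1) * (\<integral>z. (\<Sum>j<n. yc j z * ?a j z) * (1 * (\<Sum>j<n. yc j z * ?a j z)) \<partial>M) =
      (\<integral>z. 1 * (\<Sum>j<n. ?a j z * ?a j z) \<partial>M)"
    by (rule integral_tangent_pair[OF tangent_field_skew[OF assms] has_grad_mat_vec has_grad_const])
  then have "(real n - 1) * (\<integral>z. (bilin n K z)\<^sup>2 \<partial>M) = (\<integral>z. (\<Sum>j<n. ?a j z * ?a j z) \<partial>M)"
    by (simp add: bilin_eq_inner power2_eq_square)
  then have "real n * ((real n - 1) * (\<integral>z. (bilin n K z)\<^sup>2 \<partial>M)) = frobenius n (\<lambda>i j. K j i) (\<lambda>i j. K j i)"
    by (simp add: integral_inner_mat_vec)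
  also have "\<dots> = frobenius n K K"
    unfolding frobenius_def by (rule sum.swap)
  finally show ?thesis by (simp add: mult.assoc)
qed

lemma skew_fourth_moment:
  assumes "skew_on n K"
  shows "(real n - 1) * (real n + 1) * real n * (real n + 2) * (\<integral>z. (bilin n K z) ^ 4 \<partial>M) =
    3 * ((frobenius n K K)\<^sup>2 + 2 * frobenius n (row_gram n K) (row_gram n K))"
proof -
  let ?a = "mat_vec n (\<lambda>i j. K j i)"
  have "(\<Sum>j<n. ?a j z * ?a j z) = quad_form n (row_gram n K) z" for z
    unfolding inner_mat_vec by (rule quad_cong) (simp add: mat_prod_def row_gram_def)
  then have e: "(real n - 1) * (real n + 1) * (\<integral>z. (bilin n K z) ^ 4 \<partial>M) = 3 * (\<integral>z. (quad_form n (row_gram n K) z)\<^sup>2 \<partial>M)"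
    using integral_tangent_fourth[OF tangent_field_skew[OF assms]] by (simp add: bilin_eq_inner)
  have "(real n - 1) * (real n + 1) * real n * (real n + 2) * (\<integral>z. (bilin n K z) ^ 4 \<partial>M) =
      real n * (real n + 2) * ((real n - 1) * (real n + 1) * (\<integral>z. (bilin n K z) ^ 4 \<partial>M))"
    by (simp only: mult_ac)
  also have "\<dots> = 3 * (real n * (real n + 2) * (\<integral>z. (quad_form n (row_gram n K) z)\<^sup>2 \<partial>M))"
    unfolding e by (simp only: mult_ac)
  also have "real n * (real n + 2) * (\<integral>z. (quad_form n (row_gram n K) z)\<^sup>2 \<partial>M) =
      (frobenius n K K)\<^sup>2 + 2 * frobenius n (row_gram n K) (row_gram n K)"
    using integral_quad_quad[of "row_gram n K" "row_gram n K", OF symmetric_on_row_gram]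
    by (simp add: trace_row_gram power2_eq_square)
  finally show ?thesis .
qed

lemma symmetric_second_moment:
  assumes "symmetric_on n S" "mat_trace n S = 0"
  shows "(real n - 1) * (real n + 2) * (\<integral>z. (bilin n S z)\<^sup>2 \<partial>M) = frobenius n S S"
proof -
  let ?a = "sphere_field n S"
  note t = tangent_field_sphere_field[OF assms(1)]
  have g: "has_grad n (?a j) (\<lambda>k z. 2 * xc k z * mat_vec n S j z + (\<Sum>i<n. xc i z * xc i z) * S j k
       - (2 * mat_vec n S k z * xc j z + quad_form n S z * (if k = j then 1 else 0))) (\<lambda>k z. 0)" if "j < n" for j
    using t that unfolding tangent_field_def by blast
  have "(real n - 1) * (\<integral>z. (\<Sum>j<n. yc j z * ?a j z) * (1 * (\<Sum>j<n. yc j z * ?a j z)) \<partial>M) =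
      (\<integral>z. 1 * (\<Sum>j<n. ?a j z * ?a j z) \<partial>M)"
    by (rule integral_tangent_pair[OF t g has_grad_const])
  also have "(\<integral>z. (\<Sum>j<n. yc j z * ?a j z) * (1 * (\<Sum>j<n. yc j z * ?a j z)) \<partial>M) = (\<integral>z. (bilin n S z)\<^sup>2 \<partial>M)"
    by (intro Bochner_Integration.integral_cong refl)
      (simp add: inner_sphere_field[OF assms(1)] space_M power2_eq_square)
  also have "(\<integral>z. 1 * (\<Sum>j<n. ?a j z * ?a j z) \<partial>M) = (\<integral>z. quad_form n (mat_prod n S S) z - (quad_form n S z)\<^sup>2 \<partial>M)"
    by (intro Bochner_Integration.integral_cong refl)
      (simp add: norm_sphere_field[OF assms(1)] space_M)
  also have "\<dots> = (\<integral>z. quad_form n (mat_prod n S S) z \<partial>M) - (\<integral>z. (quad_form n S z)\<^sup>2 \<partial>M)"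
    by (intro Bochner_Integration.integral_diff integrable_bounded_meas bounded_meas_intros bounded_meas_quad)
  finally have e: "(real n - 1) * (\<integral>z. (bilin n S z)\<^sup>2 \<partial>M) =
      (\<integral>z. quad_form n (mat_prod n S S) z \<partial>M) - (\<integral>z. (quad_form n S z)\<^sup>2 \<partial>M)" .
  have "real n * ((real n - 1) * (real n + 2) * (\<integral>z. (bilin n S z)\<^sup>2 \<partial>M)) =
      (real n + 2) * (real n * (\<integral>z. quad_form n (mat_prod n S S) z \<partial>M)) - real n * (real n + 2) * (\<integral>z. (quad_form n S z)\<^sup>2 \<partial>M)"
    using arg_cong[OF e, of "\<lambda>u. real n * (real n + 2) * u"] by (simp add: algebra_simps)
  also have "\<dots> = real n * frobenius n S S"
    unfolding integral_quad integral_quad_square[OF assms] trace_mmul_self[OF assms(1)]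
    by (simp add: algebra_simps)
  finally show ?thesis using dim by simp
qed

text \<open>
  After integration over \<open>y\<close> the integrand is the square of \<open>|S x|\<^sup>2 - \<langle>x, S x\<rangle>\<^sup>2\<close>, the squared length of
  the tangential part of \<open>S x\<close>. Its three terms are moments on the sphere of degrees 4, 6 and 8.
\<close>

lemma symmetric_fourth_moment:
  assumes "symmetric_on n S" "mat_trace n S = 0"
  shows "(real n - 1) * (real n + 1) * real n * (real n + 2) * (real n + 4) * (real n + 6) *
      (\<integral>z. (bilin n S z) ^ 4 \<partial>M) =
    3 * (((real n)\<^sup>2 + 6 * real n + 12) * (frobenius n S S)\<^sup>2 +
      2 * real n * (real n + 2) * frobenius n (mat_prod n S S) (mat_prod n S S))"
proof -
  let ?a = "sphere_field n S" and ?q = "quad_form n S" and ?q2 = "quad_form n (mat_prod n S S)"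
  let ?N = "real n" and ?t = "frobenius n S S" and ?u = "frobenius n (mat_prod n S S) (mat_prod n S S)"
  have "(?N - 1) * (?N + 1) * (\<integral>z. (\<Sum>j<n. yc j z * ?a j z) ^ 4 \<partial>M) = 3 * (\<integral>z. (\<Sum>j<n. ?a j z * ?a j z)\<^sup>2 \<partial>M)"
    by (rule integral_tangent_fourth[OF tangent_field_sphere_field[OF assms(1)]])
  also have "(\<integral>z. (\<Sum>j<n. yc j z * ?a j z) ^ 4 \<partial>M) = (\<integral>z. (bilin n S z) ^ 4 \<partial>M)"
    by (intro Bochner_Integration.integral_cong refl)
      (simp add: inner_sphere_field[OF assms(1)] space_M)
  also have "(\<integral>z. (\<Sum>j<n. ?a j z * ?a j z)\<^sup>2 \<partial>M) = (\<integral>z. ((?q2 z)\<^sup>2 - 2 * ((?q z)\<^sup>2 * ?q2 z)) + ?q z ^ 4 \<partial>M)"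
    by (intro Bochner_Integration.integral_cong refl)
      (simp add: norm_sphere_field[OF assms(1)] space_M power2_eq_square power4_eq_xxxx algebra_simps)
  also have "\<dots> = ((\<integral>z. (?q2 z)\<^sup>2 \<partial>M) - 2 * (\<integral>z. (?q z)\<^sup>2 * ?q2 z \<partial>M)) + (\<integral>z. ?q z ^ 4 \<partial>M)"
  proof -
    note i = integrable_bounded_meas and b = bounded_meas_intros bounded_meas_quad
    have "integrable M (\<lambda>z. (?q2 z)\<^sup>2)" "integrable M (\<lambda>z. (?q z)\<^sup>2 * ?q2 z)" "integrable M (\<lambda>z. ?q z ^ 4)"
      by (intro i b)+
    then show ?thesis by simp
  qed
  finally have e: "(?N - 1) * (?N + 1) * (\<integral>z. (bilin n S z) ^ 4 \<partial>M) =
     3 * (((\<integral>z. (?q2 z)\<^sup>2 \<partial>M) - 2 * (\<integral>z. (?q z)\<^sup>2 * ?q2 z \<partial>M)) + (\<integral>z. ?q z ^ 4 \<partial>M))" .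
  have "(?N - 1) * (?N + 1) * ?N * (?N + 2) * (?N + 4) * (?N + 6) * (\<integral>z. (bilin n S z) ^ 4 \<partial>M) =
     ?N * (?N + 2) * (?N + 4) * (?N + 6) * ((?N - 1) * (?N + 1) * (\<integral>z. (bilin n S z) ^ 4 \<partial>M))"
    by (simp add: mult_ac)
  also have "\<dots> = 3 * ((?N + 4) * (?N + 6) * (?N * (?N + 2) * (\<integral>z. (?q2 z)\<^sup>2 \<partial>M))
     - 2 * (?N + 6) * (?N * (?N + 2) * (?N + 4) * (\<integral>z. (?q z)\<^sup>2 * ?q2 z \<partial>M))
     + ?N * (?N + 2) * (?N + 4) * (?N + 6) * (\<integral>z. ?q z ^ 4 \<partial>M))"
    unfolding e by (simp add: algebra_simps)
  also have "\<dots> = 3 * ((?N + 4) * (?N + 6) * (?t\<^sup>2 + 2 * ?u) - 2 * (?N + 6) * (2 * ?t\<^sup>2 + 8 * ?u) + (12 * ?t\<^sup>2 + 48 * ?u))"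
    unfolding integral_quad_mmul_square[OF assms(1)] integral_quad_square_mmul[OF assms]
      integral_quad_fourth[OF assms] ..
  also have "\<dots> = 3 * ((?N\<^sup>2 + 6 * ?N + 12) * ?t\<^sup>2 + 2 * ?N * (?N + 2) * ?u)"
    by (simp add: power2_eq_square algebra_simps)
  finally show ?thesis .
qed

text \<open>
  Integrating over \<open>y\<close> leaves the quadratic form of \<open>K S\<close>, whose trace is 0 as the trace of a product of a
  skew-symmetric and a symmetric matrix.
\<close>

lemma symmetric_skew_orthogonal:
  assumes "symmetric_on n S" "skew_on n K"
  shows "(\<integral>z. bilin n K z * bilin n S z \<partial>M) = 0"
proof -
  let ?a = "mat_vec n (\<lambda>i j. K j i)" and ?b = "mat_vec n S"
  have "(real n - 1) * (\<integral>z. (\<Sum>j<n. yc j z * ?a j z) * (1 * (\<Sum>j<n. yc j z * ?b j z)) \<partial>M) =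
      (\<integral>z. 1 * (\<Sum>j<n. ?a j z * ?b j z) \<partial>M)"
    by (rule integral_tangent_pair[OF tangent_field_skew[OF assms(2)] has_grad_mat_vec has_grad_const])
  then have "(real n - 1) * (\<integral>z. bilin n K z * bilin n S z \<partial>M) = (\<integral>z. (\<Sum>j<n. ?a j z * ?b j z) \<partial>M)"
    by (simp add: bilin_symmetric_eq_inner[OF assms(1)] bilin_eq_inner[of n K])
  then have e: "real n * ((real n - 1) * (\<integral>z. bilin n K z * bilin n S z \<partial>M)) = frobenius n (\<lambda>i j. K j i) S"
    by (simp add: integral_inner_mat_vec)
  have "frobenius n (\<lambda>i j. K j i) S = (\<Sum>j<n. \<Sum>i<n. K j i * S i j)"
    unfolding frobenius_def by (rule sum.swap)
  also have "\<dots> = (\<Sum>j<n. \<Sum>i<n. - (K i j * S j i))"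
  proof (intro sum.cong refl)
    fix i j assume "j \<in> {..<n}" "i \<in> {..<n}"
    then have "K j i = - K i j" "S i j = S j i"
      using assms unfolding symmetric_on_def skew_on_def by blast+
    then show "K j i * S i j = - (K i j * S j i)" by simp
  qed
  also have "\<dots> = - frobenius n (\<lambda>i j. K j i) S"
    by (simp add: frobenius_def sum_negf)
  finally show ?thesis using e dim by simp
qed

lemma skew_fourth_moment_le:
  assumes "skew_on n K"
  shows "(\<integral>z. (bilin n K z) ^ 4 \<partial>M) \<le> 6 * (\<integral>z. (bilin n K z)\<^sup>2 \<partial>M)\<^sup>2"
proof -
  let ?N = "real n" and ?b = "\<integral>z. (bilin n K z)\<^sup>2 \<partial>M" and ?f = "\<integral>z. (bilin n K z) ^ 4 \<partial>M"
  have N: "3 \<le> ?N" using dim by simp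
  have "(?N - 1) * (?N + 1) * ?N * (?N + 2) * ?f \<le> 6 * (frobenius n K K)\<^sup>2"
    unfolding skew_fourth_moment[OF assms] using frobenius_row_gram_skew_le[OF assms] by simp
  also have "\<dots> = 6 * (?N - 1) * ?N * ?b\<^sup>2 * (?N * (?N - 1))"
    unfolding skew_second_moment[OF assms, symmetric] by (simp add: power2_eq_square)
  also have "\<dots> \<le> 6 * (?N - 1) * ?N * ?b\<^sup>2 * ((?N + 1) * (?N + 2))"
  proof (rule mult_left_mono)
    show "?N * (?N - 1) \<le> (?N + 1) * (?N + 2)" using N by (simp add: algebra_simps)
  qed (use N in simp)
  also have "\<dots> = (?N - 1) * (?N + 1) * ?N * (?N + 2) * (6 * ?b\<^sup>2)"
    by (simp add: algebra_simps)
  finally have "(?N - 1) * (?N + 1) * ?N * (?N + 2) * ?f \<le> (?N - 1) * (?N + 1) * ?N * (?N + 2) * (6 * ?b\<^sup>2)" .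
  moreover have "0 < (?N - 1) * (?N + 1) * ?N * (?N + 2)" using N by simp
  ultimately show ?thesis by (rule mult_left_le_imp_le)
qed

lemma traceless_fourth_moment_le:
  assumes "symmetric_on n S" "mat_trace n S = 0"
  shows "(\<integral>z. (bilin n S z) ^ 4 \<partial>M) \<le> 9 * (\<integral>z. (bilin n S z)\<^sup>2 \<partial>M)\<^sup>2"
proof -
  let ?N = "real n" and ?b = "\<integral>z. (bilin n S z)\<^sup>2 \<partial>M" and ?f = "\<integral>z. (bilin n S z) ^ 4 \<partial>M"
  let ?D = "(?N - 1) * (?N + 1) * ?N * (?N + 2) * (?N + 4) * (?N + 6)"
  have N: "3 \<le> ?N" using dim by simp
  have "?D * ?f \<le> 3 * ((?N\<^sup>2 + 6 * ?N + 12) * (frobenius n S S)\<^sup>2 + 2 * ?N * (?N + 2) * (frobenius n S S)\<^sup>2)"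
    unfolding symmetric_fourth_moment[OF assms] using N frobenius_square_le[OF assms(1)]
    by (intro mult_left_mono add_left_mono) auto
  also have "\<dots> = 3 * (?N - 1) * (?N + 2) * ?b\<^sup>2 * ((?N - 1) * (?N + 2) * (3 * ?N\<^sup>2 + 10 * ?N + 12))"
    unfolding symmetric_second_moment[OF assms, symmetric] by (simp add: power2_eq_square algebra_simps)
  also have "\<dots> \<le> 3 * (?N - 1) * (?N + 2) * ?b\<^sup>2 * (3 * ?N * (?N + 1) * (?N + 4) * (?N + 6))"
  proof (rule mult_left_mono)
    have "3 * ?N * (?N + 1) * (?N + 4) * (?N + 6) - (?N - 1) * (?N + 2) * (3 * ?N\<^sup>2 + 10 * ?N + 12) =
        20 * (?N * ?N * ?N) + 86 * (?N * ?N) + 80 * ?N + 24"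
      by (simp add: power2_eq_square algebra_simps)
    also have "\<dots> \<ge> 0" using N by simp
    finally show "(?N - 1) * (?N + 2) * (3 * ?N\<^sup>2 + 10 * ?N + 12) \<le> 3 * ?N * (?N + 1) * (?N + 4) * (?N + 6)"
      by simp
  qed (use N in simp)
  also have "\<dots> = ?D * (9 * ?b\<^sup>2)"
    by (simp add: algebra_simps)
  finally have "?D * ?f \<le> ?D * (9 * ?b\<^sup>2)" .
  moreover have "0 < ?D" using N by simp
  ultimately show ?thesis by (rule mult_left_le_imp_le)
qed

lemma integral_bilin_traceless:
  "(\<integral>z. h (bilin n (traceless_part n A) z) \<partial>M) = (\<integral>z. h (bilin n A z) \<partial>M)"
  by (intro Bochner_Integration.integral_cong refl) (simp add: bilin_traceless_part space_M)

lemma symmetric_fourth_moment_le: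
  assumes "symmetric_on n S"
  shows "(\<integral>z. (bilin n S z) ^ 4 \<partial>M) \<le> 9 * (\<integral>z. (bilin n S z)\<^sup>2 \<partial>M)\<^sup>2"
  using traceless_fourth_moment_le[OF symmetric_on_traceless_part[OF assms] trace_traceless_part] dim
  by (simp add: integral_bilin_traceless[of "\<lambda>u. u ^ 4"] integral_bilin_traceless[of "\<lambda>u. u\<^sup>2"])

end

text \<open>
  A quadratic polynomial without negative values has nonpositive discriminant. When the leading coefficient
  is negative, the parameter \<open>t\<close> is chosen so large that the quadratic term outweighs the others.
\<close>

lemma discriminant_bound:
  fixes P Q R :: real
  assumes "\<And>t. 0 \<le> t\<^sup>2 * P - 2 * t * R + Q"
  shows "R\<^sup>2 \<le> P * Q"
proof (cases "P = 0")
  case True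
  have "R = 0"
  proof (rule ccontr)
    assume "R \<noteq> 0"
    then show False using assms[of "(Q + 1) / (2 * R)"] True by (simp add: field_simps)
  qed
  then show ?thesis by (simp add: True)
next
  case False
  have "0 \<le> P"
  proof (rule ccontr)
    assume "\<not> 0 \<le> P"
    then have "P < 0" by simp
    have "0 \<le> Q" using assms[of 0] by simp
    define t where "t = (\<bar>R\<bar> * 2 + Q + 1) / (- P) + 1"
    have t: "1 \<le> t" "t * (- P) = \<bar>R\<bar> * 2 + Q + 1 + (- P)"
      using \<open>P < 0\<close> \<open>0 \<le> Q\<close> by (auto simp: t_def field_simps)
    have "t * (t * (- P)) \<ge> t * (\<bar>R\<bar> * 2 + Q + 1)"
      using t \<open>P < 0\<close> by (intro mult_left_mono) auto
    moreover have "t * Q \<ge> Q" using t(1) \<open>0 \<le> Q\<close> by (simp add: mult_le_cancel_right1)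
    moreover have "t * (\<bar>R\<bar> * 2) \<ge> - (2 * t * R)" using t(1) by (simp add: abs_if)
    ultimately have "t\<^sup>2 * P - 2 * t * R + Q \<le> - t"
      by (simp add: power2_eq_square algebra_simps)
    with assms[of t] t(1) show False by linarith
  qed
  with False have "0 < P" by simp
  have "0 \<le> P * ((R / P)\<^sup>2 * P - 2 * (R / P) * R + Q)"
    by (intro mult_nonneg_nonneg assms less_imp_le[OF \<open>0 < P\<close>])
  also have "\<dots> = P * Q - R\<^sup>2" using \<open>0 < P\<close> by (simp add: field_simps power2_eq_square)
  finally show ?thesis by simp
qed

context frame_measure
begin

lemma integral_Cauchy_Schwarz:
  assumes f: "bounded_meas n f" and g: "bounded_meas n g"
  shows "(\<integral>z. f z * g z \<partial>M)\<^sup>2 \<le> (\<integral>z. (f z)\<^sup>2 \<partial>M) * (\<integral>z. (g z)\<^sup>2 \<partial>M)"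
proof (rule discriminant_bound)
  fix t :: real
  have i: "integrable M (\<lambda>z. (f z)\<^sup>2)" "integrable M (\<lambda>z. f z * g z)" "integrable M (\<lambda>z. (g z)\<^sup>2)"
    by (intro integrable_bounded_meas bounded_meas_intros f g)+
  have "0 \<le> (\<integral>z. (t * f z - g z)\<^sup>2 \<partial>M)" by simp
  also have "\<dots> = (\<integral>z. (t\<^sup>2 * (f z)\<^sup>2 - 2 * t * (f z * g z)) + (g z)\<^sup>2 \<partial>M)"
    by (intro Bochner_Integration.integral_cong refl) (simp add: power2_eq_square algebra_simps)
  also have "\<dots> = t\<^sup>2 * (\<integral>z. (f z)\<^sup>2 \<partial>M) - 2 * t * (\<integral>z. f z * g z \<partial>M) + (\<integral>z. (g z)\<^sup>2 \<partial>M)"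
    using i by simp
  finally show "0 \<le> t\<^sup>2 * (\<integral>z. (f z)\<^sup>2 \<partial>M) - 2 * t * (\<integral>z. f z * g z \<partial>M) + (\<integral>z. (g z)\<^sup>2 \<partial>M)" .
qed

text \<open>
  With \<open>a\<close> and \<open>b\<close> the second moments of the symmetric part \<open>s\<close> and the skew-symmetric part \<open>k\<close>,
  the Cauchy-Schwarz inequality gives \<open>\<integral> s\<^sup>2 k\<^sup>2 \<le> \<surd>54 a b \<le> 9 a b\<close>. Hence
  \<open>\<integral> (s + k)\<^sup>4 \<le> 4 \<integral> (s\<^sup>2 + k\<^sup>2)\<^sup>2 \<le> 36 a\<^sup>2 + 72 a b + 24 b\<^sup>2\<close>, while orthogonality makes \<open>a + b\<close> the second
  moment of \<open>s + k\<close>.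
\<close>

lemma fourth_moment_le: "(\<integral>z. (bilin n A z) ^ 4 \<partial>M) \<le> 36 * (\<integral>z. (bilin n A z)\<^sup>2 \<partial>M)\<^sup>2"
proof -
  let ?S = "\<lambda>i j. (A i j + A j i) / 2" and ?K = "\<lambda>i j. (A i j - A j i) / 2"
  let ?s = "bilin n ?S" and ?k = "bilin n ?K"
  define a where "a = (\<integral>z. (?s z)\<^sup>2 \<partial>M)"
  define b where "b = (\<integral>z. (?k z)\<^sup>2 \<partial>M)"
  define r where "r = (\<integral>z. (?s z)\<^sup>2 * (?k z)\<^sup>2 \<partial>M)"
  have S: "symmetric_on n ?S" and K: "skew_on n ?K"
    by (auto simp: symmetric_on_def skew_on_def add.commute field_simps)
  have ab: "0 \<le> a" "0 \<le> b" by (auto simp: a_def b_def)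
  have s4: "(\<integral>z. ?s z ^ 4 \<partial>M) \<le> 9 * a\<^sup>2" unfolding a_def by (rule symmetric_fourth_moment_le[OF S])
  have k4: "(\<integral>z. ?k z ^ 4 \<partial>M) \<le> 6 * b\<^sup>2" unfolding b_def by (rule skew_fourth_moment_le[OF K])
  note bm = bounded_meas_intros bounded_meas_bilin
  have i: "integrable M (\<lambda>z. ?s z ^ 4)" "integrable M (\<lambda>z. ?k z ^ 4)" "integrable M (\<lambda>z. (?s z)\<^sup>2 * (?k z)\<^sup>2)"
    "integrable M (\<lambda>z. (?s z)\<^sup>2)" "integrable M (\<lambda>z. (?k z)\<^sup>2)" "integrable M (\<lambda>z. ?k z * ?s z)"
    "integrable M (\<lambda>z. bilin n A z ^ 4)"
    by (intro integrable_bounded_meas bm)+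
  have "r\<^sup>2 \<le> (\<integral>z. ((?s z)\<^sup>2)\<^sup>2 \<partial>M) * (\<integral>z. ((?k z)\<^sup>2)\<^sup>2 \<partial>M)"
    unfolding r_def by (intro integral_Cauchy_Schwarz bm)
  also have "\<dots> \<le> (9 * a\<^sup>2) * (6 * b\<^sup>2)"
    using s4 k4 by (intro mult_mono) (simp_all add: power_mult[symmetric])
  also have "\<dots> \<le> (9 * a * b)\<^sup>2" by (simp add: power_mult_distrib)
  finally have r: "r \<le> 9 * a * b"
    using ab by (auto intro: power2_le_imp_le)
  have "(\<integral>z. (bilin n A z)\<^sup>2 \<partial>M) = (\<integral>z. ((?s z)\<^sup>2 + (?k z)\<^sup>2) + 2 * (?k z * ?s z) \<partial>M)"
    by (subst bilin_symmetric_skew_split) (simp add: power2_eq_square algebra_simps)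
  also have "\<dots> = a + b" using i symmetric_skew_orthogonal[OF S K] by (simp add: a_def b_def)
  finally have second: "(\<integral>z. (bilin n A z)\<^sup>2 \<partial>M) = a + b" .
  have "(\<integral>z. bilin n A z ^ 4 \<partial>M) \<le> (\<integral>z. (4 * ?s z ^ 4 + 4 * ?k z ^ 4) + 8 * ((?s z)\<^sup>2 * (?k z)\<^sup>2) \<partial>M)"
  proof (rule integral_mono)
    fix z
    have "(s + k) ^ 4 \<le> (4 * s ^ 4 + 4 * k ^ 4) + 8 * (s\<^sup>2 * k\<^sup>2)" for s k :: real
    proof -
      have "(s + k)\<^sup>2 \<le> 2 * s\<^sup>2 + 2 * k\<^sup>2"
        using sum_squares_bound[of s k] by (simp add: power2_sum)
      then have "((s + k)\<^sup>2)\<^sup>2 \<le> (2 * s\<^sup>2 + 2 * k\<^sup>2)\<^sup>2" by (rule power_mono) simp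
      also have "\<dots> = (4 * s ^ 4 + 4 * k ^ 4) + 8 * (s\<^sup>2 * k\<^sup>2)"
        by (simp add: power2_eq_square power4_eq_xxxx algebra_simps)
      finally show ?thesis by (simp add: power_mult[symmetric])
    qed
    then show "bilin n A z ^ 4 \<le> (4 * ?s z ^ 4 + 4 * ?k z ^ 4) + 8 * ((?s z)\<^sup>2 * (?k z)\<^sup>2)"
      by (subst bilin_symmetric_skew_split)
  qed (use i in auto)
  also have "\<dots> = 4 * (\<integral>z. ?s z ^ 4 \<partial>M) + 4 * (\<integral>z. ?k z ^ 4 \<partial>M) + 8 * r"
    using i by (simp add: r_def)
  also have "\<dots> \<le> 4 * (9 * a\<^sup>2) + 4 * (6 * b\<^sup>2) + 8 * (9 * a * b)"
    using s4 k4 r by linarith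
  also have "\<dots> \<le> 36 * (a + b)\<^sup>2"
    using ab by (simp add: power2_sum)
  finally show ?thesis unfolding second .
qed

end

section \<open>Norm inequalities and asymptotic sharpness\<close>

lemma class_fun_matrix_biform:
  "z \<in> T_space n \<Longrightarrow> class_fun (biform_class n (matrix_biform n A)) z = bilin n (\<lambda>i j. A $$ (i, j)) z"
  by (simp add: class_fun_eq_eval eval_matrix_biform)

lemma biform_class_represented:
  assumes "g \<in> biform_classes n"
  obtains A where "\<And>z. z \<in> T_space n \<Longrightarrow> class_fun g z = bilin n A z"
proof -
  obtain p where "p \<in> biforms n" "g = biform_class n p"
    using assms by (auto simp: biform_classes_def)
  then show ?thesis using that by (simp add: class_fun_eq_eval eval_biform)
qed

lemma symmetric_class_represented:
  assumes "g \<in> symmetric_classes n"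
  obtains S where "symmetric_on n S" "\<And>z. z \<in> T_space n \<Longrightarrow> class_fun g z = bilin n S z"
proof -
  obtain A where A: "A \<in> carrier_mat n n" "transpose_mat A = A" "g = biform_class n (matrix_biform n A)"
    using assms by (auto simp: symmetric_classes_def)
  have "A $$ (i, j) = A $$ (j, i)" if "i < n" "j < n" for i j
    using A(1) that arg_cong[OF A(2), of "\<lambda>B. B $$ (j, i)"] by simp
  then show ?thesis
    using that[of "\<lambda>i j. A $$ (i, j)"] A(3) by (simp add: symmetric_on_def class_fun_matrix_biform)
qed

lemma skew_symmetric_class_represented:
  assumes "g \<in> skew_symmetric_classes n"
  obtains K where "skew_on n K" "\<And>z. z \<in> T_space n \<Longrightarrow> class_fun g z = bilin n K z"
proof -
  obtain A where A: "A \<in> carrier_mat n n" "transpose_mat A = - A" "g = biform_class n (matrix_biform n A)"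
    using assms by (auto simp: skew_symmetric_classes_def)
  have "A $$ (i, j) = - A $$ (j, i)" if "i < n" "j < n" for i j
    using A(1) that arg_cong[OF A(2), of "\<lambda>B. B $$ (j, i)"] by simp
  then have "skew_on n (\<lambda>i j. A $$ (i, j))" unfolding skew_on_def by blast
  then show ?thesis
    using that[of "\<lambda>i j. A $$ (i, j)"] A(3) by (simp add: class_fun_matrix_biform)
qed

lemma root_4_le:
  assumes "f \<le> c * a\<^sup>2" "0 \<le> a"
  shows "root 4 f \<le> root 4 c * sqrt a"
proof -
  have "root 4 f \<le> root 4 (c * (sqrt a) ^ 4)"
    using assms by (simp add: real_sqrt_power_even)
  also have "\<dots> = root 4 c * sqrt a"
    using assms(2) by (simp add: real_root_mult real_root_power_cancel)
  finally show ?thesis .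
qed

lemma root_4_square: "0 \<le> c \<Longrightarrow> root 4 (c\<^sup>2) = sqrt c"
  using real_root_power_cancel[of 4 "sqrt c"] by (simp add: real_sqrt_power_even)

lemma sum_first_two:
  fixes f :: "nat \<Rightarrow> real"
  assumes "2 \<le> n" "\<And>i. 2 \<le> i \<Longrightarrow> f i = 0"
  shows "(\<Sum>i<n. f i) = f 0 + f 1"
proof -
  have "(\<Sum>i<n. f i) = (\<Sum>i\<in>{0, 1}. f i)"
    by (rule sum.mono_neutral_right) (use assms in \<open>auto simp: numeral_2_eq_2 not_less_eq_eq\<close>)
  then show ?thesis by simp
qed

text \<open>
  The extremal examples: the forms \<open>x\<^sub>0 y\<^sub>0\<close> and \<open>x\<^sub>0 y\<^sub>1 - x\<^sub>1 y\<^sub>0\<close>.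
\<close>

definition corner_mat :: "nat \<Rightarrow> real mat" where
  "corner_mat n = mat n n (\<lambda>(i, j). if i = 0 \<and> j = 0 then 1 else 0)"

definition plane_mat :: "nat \<Rightarrow> real mat" where
  "plane_mat n = mat n n (\<lambda>(i, j). if i = 0 \<and> j = 1 then 1 else if i = 1 \<and> j = 0 then - 1 else 0)"

context frame_measure
begin

lemma class_norm_eq:
  assumes "\<And>z. z \<in> T_space n \<Longrightarrow> class_fun g z = bilin n A z"
  shows "class_norm M 4 g = root 4 (\<integral>z. bilin n A z ^ 4 \<partial>M)"
    and "class_norm M 2 g = sqrt (\<integral>z. (bilin n A z)\<^sup>2 \<partial>M)"
proof -
  have e: "(\<integral>z. \<bar>class_fun g z\<bar> ^ p \<partial>M) = (\<integral>z. \<bar>bilin n A z\<bar> ^ p \<partial>M)" for p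
    by (intro Bochner_Integration.integral_cong refl) (simp add: assms space_M)
  show "class_norm M 4 g = root 4 (\<integral>z. bilin n A z ^ 4 \<partial>M)"
    "class_norm M 2 g = sqrt (\<integral>z. (bilin n A z)\<^sup>2 \<partial>M)"
    unfolding class_norm_def e by (simp_all add: sqrt_def power_even_abs)
qed

lemma class_norm_le:
  assumes "\<And>z. z \<in> T_space n \<Longrightarrow> class_fun g z = bilin n A z"
    and "(\<integral>z. bilin n A z ^ 4 \<partial>M) \<le> c * (\<integral>z. (bilin n A z)\<^sup>2 \<partial>M)\<^sup>2"
  shows "class_norm M 4 g \<le> root 4 c * class_norm M 2 g"
  using root_4_le[OF assms(2)] by (simp add: class_norm_eq[of g A] assms(1))

text \<open>
  The positive second moment also separates \<open>g\<close> from the zero class, on which the supremum of the ratios is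
  not taken.
\<close>

lemma class_norm_ratio_ge:
  assumes "\<And>z. z \<in> T_space n \<Longrightarrow> class_fun g z = bilin n A z"
    and "r * (\<integral>z. (bilin n A z)\<^sup>2 \<partial>M)\<^sup>2 \<le> (\<integral>z. bilin n A z ^ 4 \<partial>M)"
    and pos: "0 < (\<integral>z. (bilin n A z)\<^sup>2 \<partial>M)"
  shows "root 4 r \<le> class_norm M 4 g / class_norm M 2 g" and "g \<noteq> biform_class n 0"
proof -
  let ?a = "\<integral>z. (bilin n A z)\<^sup>2 \<partial>M"
  have "root 4 r * sqrt ?a = root 4 (r * (sqrt ?a) ^ 4)"
    using pos by (simp add: real_root_mult real_root_power_cancel)
  also have "\<dots> \<le> root 4 (\<integral>z. bilin n A z ^ 4 \<partial>M)"
    using assms(2) pos by (simp add: real_sqrt_power_even)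
  finally show "root 4 r \<le> class_norm M 4 g / class_norm M 2 g"
    using pos by (simp add: class_norm_eq[of g A] assms(1) pos_le_divide_eq)
  show "g \<noteq> biform_class n 0"
  proof
    assume "g = biform_class n 0"
    then have "bilin n A z = 0" if "z \<in> T_space n" for z
      using that assms(1)[OF that] by (simp add: class_fun_eq_eval eval_xy_zero)
    then have "?a = (\<integral>z. 0 \<partial>M)"
      by (intro Bochner_Integration.integral_cong refl) (simp add: space_M)
    with pos show False by simp
  qed
qed

text \<open>
  The inequality makes the set of ratios bounded above, also at a class of norm 0, where the ratio is 0 by
  the convention for division; the supremum is then at least the ratio of any nonzero class.
\<close>

lemma sharp_ratio_bounds:
  assumes "\<And>g. g \<in> G \<Longrightarrow> class_norm M 4 g \<le> C * class_norm M 2 g"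
    and "h \<in> G" "h \<noteq> biform_class n 0" "0 \<le> C"
  shows "class_norm M 4 h / class_norm M 2 h \<le> sharp_ratio M n G" and "sharp_ratio M n G \<le> C"
proof -
  have le: "class_norm M 4 g / class_norm M 2 g \<le> C" if "g \<in> G" for g
  proof (cases "class_norm M 2 g = 0")
    case False
    moreover have "0 \<le> class_norm M 2 g" by (simp add: class_norm_def)
    ultimately show ?thesis using assms(1)[OF that] by (simp add: pos_divide_le_eq)
  qed (simp add: assms(4))
  have "bdd_above ((\<lambda>g. class_norm M 4 g / class_norm M 2 g) ` (G - {biform_class n 0}))"
    using le by (auto intro!: bdd_aboveI[of _ C])
  then show "class_norm M 4 h / class_norm M 2 h \<le> sharp_ratio M n G"
    unfolding sharp_ratio_def using assms(2,3) by (intro cSUP_upper) auto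
  show "sharp_ratio M n G \<le> C"
    unfolding sharp_ratio_def using assms(2,3) le by (intro cSUP_least) auto
qed

text \<open>
  The traceless part \<open>S\<close> of the corner matrix is diagonal with entries \<open>(N - 1) / N\<close>, once, and \<open>- 1 / N\<close>.
  So \<open>\<parallel>S\<parallel>\<^sup>2 = (N - 1) / N\<close>, and the corner entry alone gives \<open>\<parallel>S\<^sup>2\<parallel>\<^sup>2 \<ge> ((N - 1) / N)\<^sup>4\<close>.
\<close>

lemma symmetric_ratio_ge:
  defines "N \<equiv> real n"
  defines "g \<equiv> biform_class n (matrix_biform n (corner_mat n))"
  shows "root 4 (3 * (N - 1) * (N + 2) * ((N\<^sup>2 + 6 * N + 12) + 2 * N * (N + 2) * ((N - 1) / N)\<^sup>2) /
      ((N + 1) * N * (N + 4) * (N + 6))) \<le> class_norm M 4 g / class_norm M 2 g"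
    and "g \<in> symmetric_classes n" and "g \<noteq> biform_class n 0"
proof -
  have N: "3 \<le> N" using dim by (simp add: N_def)
  let ?A = "\<lambda>i j. corner_mat n $$ (i, j)"
  define S where "S = traceless_part n ?A"
  have A: "?A i j = (if i = 0 \<and> j = 0 then 1 else 0)" if "i < n" "j < n" for i j
    using that by (simp add: corner_mat_def)
  have "mat_trace n ?A = (\<Sum>i<n. if i = 0 then 1 else 0)"
    unfolding mat_trace_def by (intro sum.cong) (auto simp: A)
  then have trA: "mat_trace n ?A = 1" using dim by simp
  have S_eq: "S i j = (if i = j then (if i = 0 then (N - 1) / N else - 1 / N) else 0)" if "i < n" "j < n" for i j
    using that N by (auto simp: S_def traceless_part_def trA A N_def field_simps)
  have sym: "symmetric_on n S" by (auto simp: symmetric_on_def S_eq)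
  have tr: "mat_trace n S = 0" unfolding S_def using dim by (intro trace_traceless_part) simp
  have split: "(\<Sum>i<n. if i = 0 then u else v) = u + (N - 1) * v" for u v :: real
  proof -
    have "(\<Sum>i<n. if i = 0 then u else v) = (\<Sum>i<n. v + (if i = 0 then u - v else 0))"
      by (intro sum.cong) auto
    then show ?thesis using dim by (simp add: sum.distrib N_def algebra_simps)
  qed
  have "frobenius n S S = (\<Sum>i<n. if i = 0 then ((N - 1) / N)\<^sup>2 else 1 / N\<^sup>2)"
  proof -
    have "(\<Sum>j<n. S i j * S i j) = (if i = 0 then ((N - 1) / N)\<^sup>2 else 1 / N\<^sup>2)" if "i < n" for i
    proof -
      have "(\<Sum>j<n. S i j * S i j) = (\<Sum>j<n. if j = i then (if i = 0 then ((N - 1) / N)\<^sup>2 else 1 / N\<^sup>2) else 0)"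
        using that by (intro sum.cong) (auto simp: S_eq power2_eq_square)
      then show ?thesis using that by simp
    qed
    then show ?thesis unfolding frobenius_def by (intro sum.cong) auto
  qed
  also have "\<dots> = ((N - 1) / N)\<^sup>2 + (N - 1) * (1 / N\<^sup>2)" by (rule split)
  also have "\<dots> = (N - 1) / N" using N by (simp add: power2_eq_square field_simps)
  finally have t: "frobenius n S S = (N - 1) / N" .
  have "((N - 1) / N) ^ 4 \<le> frobenius n (mat_prod n S S) (mat_prod n S S)"
  proof -
    have "mat_prod n S S 0 0 = (\<Sum>k<n. if k = 0 then ((N - 1) / N)\<^sup>2 else 0)"
      unfolding mat_prod_def using dim by (intro sum.cong) (auto simp: S_eq power2_eq_square)
    then have "mat_prod n S S 0 0 = ((N - 1) / N)\<^sup>2" using dim by simp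
    then have "((N - 1) / N) ^ 4 = mat_prod n S S 0 0 * mat_prod n S S 0 0"
      by (simp add: power2_eq_square power4_eq_xxxx mult.assoc)
    also have "\<dots> \<le> (\<Sum>j<n. mat_prod n S S 0 j * mat_prod n S S 0 j)"
      using dim by (intro member_le_sum[of 0 "{..<n}" "\<lambda>j. mat_prod n S S 0 j * mat_prod n S S 0 j"]) auto
    also have "\<dots> \<le> frobenius n (mat_prod n S S) (mat_prod n S S)"
      unfolding frobenius_def using dim
      by (intro member_le_sum[of 0 "{..<n}" "\<lambda>i. \<Sum>j<n. mat_prod n S S i j * mat_prod n S S i j"]) (auto intro: sum_nonneg)
    finally show ?thesis .
  qed
  then have u: "((N - 1) / N)\<^sup>2 * (frobenius n S S)\<^sup>2 \<le> frobenius n (mat_prod n S S) (mat_prod n S S)"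
    unfolding t by (simp add: power_add[symmetric])
  let ?b = "\<integral>z. (bilin n S z)\<^sup>2 \<partial>M" and ?f = "\<integral>z. (bilin n S z) ^ 4 \<partial>M"
  let ?P = "(N\<^sup>2 + 6 * N + 12) + 2 * N * (N + 2) * ((N - 1) / N)\<^sup>2"
  let ?E = "(N + 1) * N * (N + 4) * (N + 6)"
  have m2: "(N - 1) * (N + 2) * ?b = frobenius n S S"
    unfolding N_def by (rule symmetric_second_moment[OF sym tr])
  have m4: "(N - 1) * (N + 1) * N * (N + 2) * (N + 4) * (N + 6) * ?f =
      3 * ((N\<^sup>2 + 6 * N + 12) * (frobenius n S S)\<^sup>2 + 2 * N * (N + 2) * frobenius n (mat_prod n S S) (mat_prod n S S))"
    unfolding N_def by (rule symmetric_fourth_moment[OF sym tr])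
  have "0 < (N - 1) * (N + 2) * ?b" unfolding m2 t using N by simp
  then have "?b \<noteq> 0" by auto
  moreover have "0 \<le> ?b" by simp
  ultimately have b: "0 < ?b" by linarith
  have "((N - 1) * (N + 2)) * (3 * (N - 1) * (N + 2) * ?P * ?b\<^sup>2) = 3 * ?P * ((N - 1) * (N + 2) * ?b)\<^sup>2"
    by (simp only: power2_eq_square mult_ac)
  also have "\<dots> = 3 * ((N\<^sup>2 + 6 * N + 12) * (frobenius n S S)\<^sup>2 + 2 * N * (N + 2) * (((N - 1) / N)\<^sup>2 * (frobenius n S S)\<^sup>2))"
    unfolding m2 by (simp only: distrib_right mult.assoc)
  also have "\<dots> \<le> (N - 1) * (N + 1) * N * (N + 2) * (N + 4) * (N + 6) * ?f"
    unfolding m4 using u N by (intro mult_left_mono add_left_mono) auto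
  also have "\<dots> = ((N - 1) * (N + 2)) * (?E * ?f)" by (simp only: mult_ac)
  finally have le: "((N - 1) * (N + 2)) * (3 * (N - 1) * (N + 2) * ?P * ?b\<^sup>2) \<le> ((N - 1) * (N + 2)) * (?E * ?f)" .
  have pos: "0 < (N - 1) * (N + 2)" "0 < ?E" using N by simp_all
  have "3 * (N - 1) * (N + 2) * ?P * ?b\<^sup>2 \<le> ?E * ?f"
    by (rule mult_left_le_imp_le[OF le pos(1)])
  then have r: "3 * (N - 1) * (N + 2) * ?P / ?E * ?b\<^sup>2 \<le> ?f"
    unfolding times_divide_eq_left pos_divide_le_eq[OF pos(2)] by (simp only: mult.commute)
  have rep: "class_fun g z = bilin n S z" if "z \<in> T_space n" for z
    using that by (simp add: g_def S_def class_fun_matrix_biform bilin_traceless_part)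
  show "root 4 (3 * (N - 1) * (N + 2) * ?P / ?E) \<le> class_norm M 4 g / class_norm M 2 g"
    "g \<noteq> biform_class n 0"
    using class_norm_ratio_ge[OF rep r b] by auto
  have "transpose_mat (corner_mat n) = corner_mat n" by (auto simp: corner_mat_def intro!: eq_matI)
  moreover have "corner_mat n \<in> carrier_mat n n" by (simp add: corner_mat_def)
  ultimately show "g \<in> symmetric_classes n"
    unfolding symmetric_classes_def g_def by blast
qed

text \<open>
  For the rank 2 matrix \<open>K\<close> both \<open>\<parallel>K\<parallel>\<^sup>2\<close> and \<open>\<parallel>K K\<^sup>T\<parallel>\<^sup>2\<close> are 2, the equality case of
  \<open>frobenius_row_gram_skew_le\<close>.
\<close>

lemma skew_symmetric_ratio_ge:
  defines "N \<equiv> real n"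
  defines "g \<equiv> biform_class n (matrix_biform n (plane_mat n))"
  shows "root 4 (6 * N * (N - 1) / ((N + 1) * (N + 2))) \<le> class_norm M 4 g / class_norm M 2 g"
    and "g \<in> skew_symmetric_classes n" and "g \<noteq> biform_class n 0"
proof -
  have N: "3 \<le> N" using dim by (simp add: N_def)
  define K where "K = (\<lambda>(i :: nat) (j :: nat). if i = 0 \<and> j = 1 then 1 else if i = 1 \<and> j = 0 then - 1 else 0 :: real)"
  have skew: "skew_on n K" by (auto simp: skew_on_def K_def)
  have n2: "2 \<le> n" using dim by simp
  have F: "frobenius n K K = 2"
    unfolding frobenius_def by (simp add: sum_first_two[OF n2] K_def)
  have G: "row_gram n K i j = (if i = j \<and> i < 2 then 1 else 0)" for i j
    unfolding row_gram_def by (auto simp: sum_first_two[OF n2] K_def)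
  have U: "frobenius n (row_gram n K) (row_gram n K) = 2"
    unfolding frobenius_def G by (simp add: sum_first_two[OF n2])
  let ?b = "\<integral>z. (bilin n K z)\<^sup>2 \<partial>M" and ?f = "\<integral>z. (bilin n K z) ^ 4 \<partial>M"
  have m2: "N * (N - 1) * ?b = 2"
    using skew_second_moment[OF skew] by (simp add: F N_def)
  have m4: "(N - 1) * (N + 1) * N * (N + 2) * ?f = 24"
    using skew_fourth_moment[OF skew] by (simp add: F U N_def)
  have "0 < N * (N - 1) * ?b" by (simp add: m2)
  then have "?b \<noteq> 0" by auto
  moreover have "0 \<le> ?b" by simp
  ultimately have b: "0 < ?b" by linarith
  have "(N * (N - 1)) * (6 * N * (N - 1) * ?b\<^sup>2) = 6 * (N * (N - 1) * ?b)\<^sup>2"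
    by (simp add: power2_eq_square)
  also have "\<dots> = (N - 1) * (N + 1) * N * (N + 2) * ?f" unfolding m2 m4 by simp
  also have "\<dots> = (N * (N - 1)) * ((N + 1) * (N + 2) * ?f)" by (simp only: mult_ac)
  finally have "6 * N * (N - 1) * ?b\<^sup>2 \<le> (N + 1) * (N + 2) * ?f"
    using N by simp
  then have r: "6 * N * (N - 1) / ((N + 1) * (N + 2)) * ?b\<^sup>2 \<le> ?f"
    using N by (simp add: pos_divide_le_eq mult.commute)
  have rep: "class_fun g z = bilin n K z" if "z \<in> T_space n" for z
    using that unfolding g_def class_fun_matrix_biform[OF that] bilin_def
    by (intro sum.cong refl) (simp add: plane_mat_def K_def)
  show "root 4 (6 * N * (N - 1) / ((N + 1) * (N + 2))) \<le> class_norm M 4 g / class_norm M 2 g"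
    "g \<noteq> biform_class n 0"
    using class_norm_ratio_ge[OF rep r b] by auto
  have "transpose_mat (plane_mat n) = - plane_mat n" by (auto simp: plane_mat_def intro!: eq_matI)
  moreover have "plane_mat n \<in> carrier_mat n n" by (simp add: plane_mat_def)
  ultimately show "g \<in> skew_symmetric_classes n"
    unfolding skew_symmetric_classes_def g_def by blast
qed

lemma class_norm_bounds:
  shows "g \<in> biform_classes n \<Longrightarrow> class_norm M 4 g \<le> sqrt 6 * class_norm M 2 g"
    and "g \<in> symmetric_classes n \<Longrightarrow> class_norm M 4 g \<le> sqrt 3 * class_norm M 2 g"
    and "g \<in> skew_symmetric_classes n \<Longrightarrow> class_norm M 4 g \<le> root 4 6 * class_norm M 2 g"
proof -
  have c: "root 4 36 = sqrt 6" "root 4 9 = sqrt 3"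
    using root_4_square[of 6] root_4_square[of 3] by simp_all
  show "class_norm M 4 g \<le> sqrt 6 * class_norm M 2 g" if "g \<in> biform_classes n"
    using biform_class_represented[OF that] class_norm_le[OF _ fourth_moment_le] unfolding c by metis
  show "class_norm M 4 g \<le> sqrt 3 * class_norm M 2 g" if "g \<in> symmetric_classes n"
    using symmetric_class_represented[OF that] class_norm_le[OF _ symmetric_fourth_moment_le] unfolding c by metis
  show "class_norm M 4 g \<le> root 4 6 * class_norm M 2 g" if "g \<in> skew_symmetric_classes n"
    using skew_symmetric_class_represented[OF that] class_norm_le[OF _ skew_fourth_moment_le] by metis
qed

lemma sharp_ratio_symmetric_bounds:
  defines "N \<equiv> real n"
  shows "root 4 (3 * (N - 1) * (N + 2) * ((N\<^sup>2 + 6 * N + 12) + 2 * N * (N + 2) * ((N - 1) / N)\<^sup>2) /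
      ((N + 1) * N * (N + 4) * (N + 6))) \<le> sharp_ratio M n (symmetric_classes n)"
    and "sharp_ratio M n (symmetric_classes n) \<le> sqrt 3"
  using symmetric_ratio_ge sharp_ratio_bounds[OF class_norm_bounds(2) symmetric_ratio_ge(2,3)]
  unfolding N_def by (auto intro: order_trans)

lemma sharp_ratio_skew_symmetric_bounds:
  defines "N \<equiv> real n"
  shows "root 4 (6 * N * (N - 1) / ((N + 1) * (N + 2))) \<le> sharp_ratio M n (skew_symmetric_classes n)"
    and "sharp_ratio M n (skew_symmetric_classes n) \<le> root 4 6"
  using skew_symmetric_ratio_ge sharp_ratio_bounds[OF class_norm_bounds(3) skew_symmetric_ratio_ge(2,3)]
  unfolding N_def by (auto intro: order_trans)

end

theorem proposition4p10:
  fixes \<sigma> :: "nat \<Rightarrow> (real vec \<times> real vec) measure"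
  assumes "\<And>n. n \<ge> 3 \<Longrightarrow> invariant_prob_T n (\<sigma> n)"
  shows "(\<forall>n\<ge>3.
            (\<forall>g \<in> biform_classes n. class_norm (\<sigma> n) 4 g \<le> sqrt 6 * class_norm (\<sigma> n) 2 g) \<and>
            (\<forall>g \<in> symmetric_classes n. class_norm (\<sigma> n) 4 g \<le> sqrt 3 * class_norm (\<sigma> n) 2 g) \<and>
            (\<forall>g \<in> skew_symmetric_classes n.
               class_norm (\<sigma> n) 4 g \<le> root 4 6 * class_norm (\<sigma> n) 2 g)) \<and>
         (\<lambda>n. sharp_ratio (\<sigma> n) n (symmetric_classes n)) \<longlonglongrightarrow> sqrt 3 \<and>
         (\<lambda>n. sharp_ratio (\<sigma> n) n (skew_symmetric_classes n)) \<longlonglongrightarrow> root 4 6"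
proof (intro conjI allI impI ballI)
  have fm: "frame_measure n (\<sigma> n)" if "3 \<le> n" for n
    using assms[OF that] that by unfold_locales
  fix n :: nat and g assume n: "3 \<le> n"
  interpret frame_measure n "\<sigma> n" by (rule fm[OF n])
  show "g \<in> biform_classes n \<Longrightarrow> class_norm (\<sigma> n) 4 g \<le> sqrt 6 * class_norm (\<sigma> n) 2 g"
    "g \<in> symmetric_classes n \<Longrightarrow> class_norm (\<sigma> n) 4 g \<le> sqrt 3 * class_norm (\<sigma> n) 2 g"
    "g \<in> skew_symmetric_classes n \<Longrightarrow> class_norm (\<sigma> n) 4 g \<le> root 4 6 * class_norm (\<sigma> n) 2 g"
    by (rule class_norm_bounds; assumption)+
next
  have fm: "frame_measure n (\<sigma> n)" if "3 \<le> n" for n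
    using assms[OF that] that by unfold_locales
  let ?r = "\<lambda>N::real. 3 * (N - 1) * (N + 2) * ((N\<^sup>2 + 6 * N + 12) + 2 * N * (N + 2) * ((N - 1) / N)\<^sup>2) /
      ((N + 1) * N * (N + 4) * (N + 6))"
  show "(\<lambda>n. sharp_ratio (\<sigma> n) n (symmetric_classes n)) \<longlonglongrightarrow> sqrt 3"
  proof (rule tendsto_sandwich)
    show "\<forall>\<^sub>F n in sequentially. root 4 (?r (real n)) \<le> sharp_ratio (\<sigma> n) n (symmetric_classes n)"
      "\<forall>\<^sub>F n in sequentially. sharp_ratio (\<sigma> n) n (symmetric_classes n) \<le> sqrt 3"
      using frame_measure.sharp_ratio_symmetric_bounds[OF fm]
      by (auto simp: eventually_sequentially intro!: exI[of _ 3])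
    have "(\<lambda>n. ?r (real n)) \<longlonglongrightarrow> 9" by real_asymp
    then have "(\<lambda>n. root 4 (?r (real n))) \<longlonglongrightarrow> root 4 (3\<^sup>2)" by (simp add: tendsto_real_root)
    then show "(\<lambda>n. root 4 (?r (real n))) \<longlonglongrightarrow> sqrt 3" by (simp only: root_4_square)
  qed simp
  let ?s = "\<lambda>N::real. 6 * N * (N - 1) / ((N + 1) * (N + 2))"
  show "(\<lambda>n. sharp_ratio (\<sigma> n) n (skew_symmetric_classes n)) \<longlonglongrightarrow> root 4 6"
  proof (rule tendsto_sandwich)
    show "\<forall>\<^sub>F n in sequentially. root 4 (?s (real n)) \<le> sharp_ratio (\<sigma> n) n (skew_symmetric_classes n)"
      "\<forall>\<^sub>F n in sequentially. sharp_ratio (\<sigma> n) n (skew_symmetric_classes n) \<le> root 4 6"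
      using frame_measure.sharp_ratio_skew_symmetric_bounds[OF fm]
      by (auto simp: eventually_sequentially intro!: exI[of _ 3])
    have "(\<lambda>n. ?s (real n)) \<longlonglongrightarrow> 6" by real_asymp
    then show "(\<lambda>n. root 4 (?s (real n))) \<longlonglongrightarrow> root 4 6" by (rule tendsto_real_root)
  qed simp
qed

end
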